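(* A Riemannian almost product $\mathcal{W}_3$-manifold $(M,P,g)$ is a Riemannian $P$-manifold (i.e. $\nabla P=0$) if and only if the scalar curvatures $\tau'$ of the canonical connection $\nabla'$ and $\tau$ of the Levi-Civita connection $\nabla$ are equal.
   Context: A Riemannian almost product manifold $(M,P,g)$ is a differentiable manifold $M$ with a $(1,1)$-tensor field $P$ and a Riemannian metric $g$ such that $P^2x=x$ and $g(Px,Py)=g(x,y)$ for all vector fields $x,y$; throughout it is assumed that $\mathrm{tr}\,P=0$. Let $\nabla$ be the Levi-Civita connection of $g$ and $F(x,y,z)=g((\nabla_xP)y,z)$. $(M,P,g)$ is a Riemannian $P$-manifold if $F=0$, equivalently $\nabla P=0$. $(M,P,g)$ is a Riemannian almost product $\mathcal{W}_3$-manifold if $F(x,y,z)+F(y,z,x)+F(z,x,y)=0$ for all $x,y,z$. A natural connection is a linear connection $\nabla'$ with $\nabla'P=0$ and $\nabla'g=0$; its torsion is $T(x,y)=\nabla'_xy-\nabla'_yx-[x,y]$, with $T(x,y,z)=g(T(x,y),z)$. The canonical connection is the natural connection whose torsion satisfies \[T(x,y,z)+T(y,z,x)+T(Px,y,Pz)+T(y,Pz,Px)=0\] for all $x,y,z$; it is known that it exists and is unique on every Riemannian almost product manifold. Curvature: $R(x,y)z=\nabla_x\nabla_yz-\nabla_y\nabla_xz-\nabla_{[x,y]}z$, $R(x,y,z,w)=g(R(x,y)z,w)$, and $R'$ is defined in the same way from $\nabla'$. For a basis $\{e_i\}$ of $T_pM$, with $g^{ij}$ the components of the inverse matrix of $g$,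 $\rho(y,z)=g^{ij}R(e_i,y,z,e_j)$, $\tau=g^{ij}\rho(e_i,e_j)$, and $\rho',\tau'$ are defined in the same way from $R'$ (summation convention). *)

theory Defs
  imports "HOL-Analysis.Analysis" "HOL-Library.Function_Algebras"
begin

section \<open>Smooth maps between Euclidean spaces\<close>

text \<open>
  For open \<open>S\<close> and a finite-dimensional domain, \<open>Ck_on k f S\<close> says that \<open>f\<close> is of class
  \<open>C\<^sup>k\<close> on \<open>S\<close>: all iterated directional derivatives up to order \<open>k\<close> exist and are continuous.
\<close>

primrec Ck_on :: "nat \<Rightarrow> ('v::real_normed_vector \<Rightarrow> 'w::real_normed_vector) \<Rightarrow> 'v set \<Rightarrow> bool" where
  "Ck_on 0 f S \<longleftrightarrow> continuous_on S f"
| "Ck_on (Suc k) f S \<longleftrightarrow>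
     (\<forall>x\<in>S. f differentiable (at x)) \<and> (\<forall>v. Ck_on k (\<lambda>x. frechet_derivative f (at x) v) S)"

definition smooth_on :: "('v::real_normed_vector \<Rightarrow> 'w::real_normed_vector) \<Rightarrow> 'v set \<Rightarrow> bool" where
  "smooth_on f S \<longleftrightarrow> (\<forall>k. Ck_on k f S)"


section \<open>Differentiable manifolds\<close>

text \<open>
  A manifold has a Hausdorff, second countable space type \<open>'a\<close> as its underlying space; a chart is
  a pair of its domain and its coordinate map. The dimension is \<open>CARD('n)\<close>. The atlas is not
  required to be maximal, since all notions below depend on it only through \<open>Cinf\<close>.
\<close>

type_synonym ('a, 'n) atlas = "('a set \<times> ('a \<Rightarrow> real ^ 'n)) set"

definition smooth_manifold ::
    "('a::{t2_space,second_countable_topology}, 'n::finite) atlas \<Rightarrow> bool" where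
  "smooth_manifold A \<longleftrightarrow>
     (\<Union>(U, \<phi>)\<in>A. U) = UNIV \<and>
     (\<forall>(U, \<phi>)\<in>A. open U \<and> open (\<phi> ` U) \<and> homeomorphism U (\<phi> ` U) \<phi> (inv_into U \<phi>)) \<and>
     (\<forall>(U, \<phi>)\<in>A. \<forall>(V, \<psi>)\<in>A. smooth_on (\<psi> \<circ> inv_into U \<phi>) (\<phi> ` (U \<inter> V)))"

definition Cinf :: "('a::{t2_space,second_countable_topology}, 'n::finite) atlas \<Rightarrow> ('a \<Rightarrow> real) set" where
  "Cinf A = {f. \<forall>(U, \<phi>)\<in>A. smooth_on (f \<circ> inv_into U \<phi>) (\<phi> ` U)}"


section \<open>Tangent vectors and vector fields\<close>

text \<open>
  The arithmetic operations on functions are the pointwise ones. Tangent vectors at a point and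
  vector fields are derivations on the algebra of smooth functions; both are set to 0 on non-smooth
  functions, so that equality in HOL is equality of tangent vectors and of vector fields. Every
  derivation below is \<open>\<real>\<close>-linear.
\<close>

type_synonym 'a tangent = "('a \<Rightarrow> real) \<Rightarrow> real"
type_synonym 'a vfield = "('a \<Rightarrow> real) \<Rightarrow> 'a \<Rightarrow> real"
type_synonym 'a connection = "'a vfield \<Rightarrow> 'a vfield \<Rightarrow> 'a vfield"
type_synonym 'a tensor11 = "'a vfield \<Rightarrow> 'a vfield"
type_synonym 'a tensor02 = "'a vfield \<Rightarrow> 'a vfield \<Rightarrow> 'a \<Rightarrow> real"

definition tangent_space ::
    "('a::{t2_space,second_countable_topology}, 'n::finite) atlas \<Rightarrow> 'a \<Rightarrow> 'a tangent set" where
  "tangent_space A p = {v.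
     (\<forall>f. f \<notin> Cinf A \<longrightarrow> v f = 0) \<and>
     (\<forall>f\<in>Cinf A. \<forall>h\<in>Cinf A. v (f + h) = v f + v h) \<and>
     (\<forall>c. \<forall>f\<in>Cinf A. v (\<lambda>q. c * f q) = c * v f) \<and>
     (\<forall>f\<in>Cinf A. \<forall>h\<in>Cinf A. v (f * h) = f p * v h + h p * v f)}"

definition vector_fields ::
    "('a::{t2_space,second_countable_topology}, 'n::finite) atlas \<Rightarrow> 'a vfield set" where
  "vector_fields A = {x.
     (\<forall>f\<in>Cinf A. x f \<in> Cinf A) \<and>
     (\<forall>p. (\<lambda>f. x f p) \<in> tangent_space A p)}"

definition smult :: "('a \<Rightarrow> real) \<Rightarrow> 'a vfield \<Rightarrow> 'a vfield" where
  "smult f x = (\<lambda>h. f * x h)"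

definition lie_bracket :: "'a vfield \<Rightarrow> 'a vfield \<Rightarrow> 'a vfield" where
  "lie_bracket x y = (\<lambda>f. x (y f) - y (x f))"

text \<open>
  Vector fields \<open>e i\<close> (indexed by the coordinate type \<open>'n\<close>) whose values at \<open>p\<close> form a basis of
  the tangent space at \<open>p\<close>.
\<close>

definition basis_at ::
    "('a::{t2_space,second_countable_topology}, 'n::finite) atlas \<Rightarrow> 'a \<Rightarrow> ('n \<Rightarrow> 'a vfield) \<Rightarrow> bool" where
  "basis_at A p e \<longleftrightarrow>
     (\<forall>i. e i \<in> vector_fields A) \<and>
     (\<forall>c. (\<forall>f. (\<Sum>i\<in>UNIV. c i * e i f p) = 0) \<longrightarrow> (\<forall>i. c i = 0)) \<and>
     (\<forall>v\<in>tangent_space A p. \<exists>c. \<forall>f. v f = (\<Sum>i\<in>UNIV. c i * e i f p))"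

text \<open>
  Tensors at \<open>p\<close> are contracted with respect to this arbitrarily chosen basis; the contractions
  do not depend on the choice.
\<close>

definition basis_of ::
    "('a::{t2_space,second_countable_topology}, 'n::finite) atlas \<Rightarrow> 'a \<Rightarrow> 'n \<Rightarrow> 'a vfield" where
  "basis_of A p = (SOME e. basis_at A p e)"


section \<open>Tensor fields and linear connections\<close>

text \<open>Tensor fields are \<open>C\<^sup>\<infinity>(M)\<close>-multilinear maps on vector fields.\<close>

definition tensor_field_11 ::
    "('a::{t2_space,second_countable_topology}, 'n::finite) atlas \<Rightarrow> 'a tensor11 \<Rightarrow> bool" where
  "tensor_field_11 A P \<longleftrightarrow>
     (\<forall>x\<in>vector_fields A. P x \<in> vector_fields A) \<and>
     (\<forall>x\<in>vector_fields A. \<forall>y\<in>vector_fields A. P (x + y) = P x + P y) \<and>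
     (\<forall>f\<in>Cinf A. \<forall>x\<in>vector_fields A. P (smult f x) = smult f (P x))"

definition riemannian_metric ::
    "('a::{t2_space,second_countable_topology}, 'n::finite) atlas \<Rightarrow> 'a tensor02 \<Rightarrow> bool" where
  "riemannian_metric A g \<longleftrightarrow>
     (\<forall>x\<in>vector_fields A. \<forall>y\<in>vector_fields A. g x y \<in> Cinf A) \<and>
     (\<forall>x\<in>vector_fields A. \<forall>y\<in>vector_fields A. \<forall>z\<in>vector_fields A. g (x + y) z = g x z + g y z) \<and>
     (\<forall>f\<in>Cinf A. \<forall>x\<in>vector_fields A. \<forall>y\<in>vector_fields A. g (smult f x) y = f * g x y) \<and>
     (\<forall>x\<in>vector_fields A. \<forall>y\<in>vector_fields A. g x y = g y x) \<and>
     (\<forall>x\<in>vector_fields A. \<forall>p. (\<exists>f. x f p \<noteq> 0) \<longrightarrow> g x x p > 0)"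

definition trace_at ::
    "('a::{t2_space,second_countable_topology}, 'n::finite) atlas \<Rightarrow> 'a tensor11 \<Rightarrow> 'a \<Rightarrow> real" where
  "trace_at A P p = (let e = basis_of A p in
     trace (THE m :: real ^ 'n ^ 'n. \<forall>j f. P (e j) f p = (\<Sum>i\<in>UNIV. m $ i $ j * e i f p)))"

definition linear_connection ::
    "('a::{t2_space,second_countable_topology}, 'n::finite) atlas \<Rightarrow> 'a connection \<Rightarrow> bool" where
  "linear_connection A D \<longleftrightarrow>
     (\<forall>x\<in>vector_fields A. \<forall>y\<in>vector_fields A. D x y \<in> vector_fields A) \<and>
     (\<forall>x\<in>vector_fields A. \<forall>y\<in>vector_fields A. \<forall>z\<in>vector_fields A.
        D (x + y) z = D x z + D y z \<and> D x (y + z) = D x y + D x z) \<and>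
     (\<forall>f\<in>Cinf A. \<forall>x\<in>vector_fields A. \<forall>y\<in>vector_fields A.
        D (smult f x) y = smult f (D x y) \<and>
        D x (smult f y) = smult (x f) y + smult f (D x y))"

text \<open>\<open>(D\<^sub>x P) y\<close>, \<open>(D\<^sub>x g)(y, z)\<close>, and the torsion and curvature of a linear connection \<open>D\<close>.\<close>

definition deriv_P :: "'a connection \<Rightarrow> 'a tensor11 \<Rightarrow> 'a vfield \<Rightarrow> 'a vfield \<Rightarrow> 'a vfield" where
  "deriv_P D P x y = D x (P y) - P (D x y)"

definition deriv_g ::
    "'a connection \<Rightarrow> 'a tensor02 \<Rightarrow> 'a vfield \<Rightarrow> 'a vfield \<Rightarrow> 'a vfield \<Rightarrow> 'a \<Rightarrow> real" where
  "deriv_g D g x y z = x (g y z) - g (D x y) z - g y (D x z)"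

definition torsion :: "'a connection \<Rightarrow> 'a vfield \<Rightarrow> 'a vfield \<Rightarrow> 'a vfield" where
  "torsion D x y = D x y - D y x - lie_bracket x y"

definition curvature :: "'a connection \<Rightarrow> 'a vfield \<Rightarrow> 'a vfield \<Rightarrow> 'a vfield \<Rightarrow> 'a vfield" where
  "curvature D x y z = D x (D y z) - D y (D x z) - D (lie_bracket x y) z"

definition levi_civita ::
    "('a::{t2_space,second_countable_topology}, 'n::finite) atlas \<Rightarrow> 'a tensor02 \<Rightarrow> 'a connection \<Rightarrow> bool" where
  "levi_civita A g D \<longleftrightarrow> linear_connection A D \<and>
     (\<forall>x\<in>vector_fields A. \<forall>y\<in>vector_fields A. torsion D x y = 0) \<and>
     (\<forall>x\<in>vector_fields A. \<forall>y\<in>vector_fields A. \<forall>z\<in>vector_fields A. deriv_g D g x y z = 0)"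

text \<open>The components \<open>g\<^sup>i\<^sup>j\<close> at \<open>p\<close> with respect to the basis \<open>e\<close>.\<close>

definition inverse_metric :: "'a tensor02 \<Rightarrow> ('n::finite \<Rightarrow> 'a vfield) \<Rightarrow> 'a \<Rightarrow> real ^ 'n ^ 'n" where
  "inverse_metric g e p = matrix_inv (\<chi> i j. g (e i) (e j) p)"

definition ricci ::
    "('a::{t2_space,second_countable_topology}, 'n::finite) atlas \<Rightarrow> 'a tensor02 \<Rightarrow> 'a connection \<Rightarrow> 'a tensor02" where
  "ricci A g D y z p = (let e = basis_of A p in
     \<Sum>i\<in>UNIV. \<Sum>j\<in>UNIV. inverse_metric g e p $ i $ j * g (curvature D (e i) y z) (e j) p)"

definition scalar_curvature ::
    "('a::{t2_space,second_countable_topology}, 'n::finite) atlas \<Rightarrow> 'a tensor02 \<Rightarrow> 'a connection \<Rightarrow> 'a \<Rightarrow> real" where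
  "scalar_curvature A g D p = (let e = basis_of A p in
     \<Sum>i\<in>UNIV. \<Sum>j\<in>UNIV. inverse_metric g e p $ i $ j * ricci A g D (e i) (e j) p)"


section \<open>Riemannian almost product manifolds\<close>

definition riemannian_almost_product ::
    "('a::{t2_space,second_countable_topology}, 'n::finite) atlas \<Rightarrow> 'a tensor11 \<Rightarrow> 'a tensor02 \<Rightarrow> bool" where
  "riemannian_almost_product A P g \<longleftrightarrow>
     smooth_manifold A \<and> tensor_field_11 A P \<and> riemannian_metric A g \<and>
     (\<forall>x\<in>vector_fields A. P (P x) = x) \<and>
     (\<forall>x\<in>vector_fields A. \<forall>y\<in>vector_fields A. g (P x) (P y) = g x y) \<and>
     (\<forall>p. trace_at A P p = 0)"

text \<open>In the following definitions \<open>D\<close> is the Levi-Civita connection of \<open>g\<close>.\<close>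

definition F_tensor ::
    "'a connection \<Rightarrow> 'a tensor11 \<Rightarrow> 'a tensor02 \<Rightarrow> 'a vfield \<Rightarrow> 'a vfield \<Rightarrow> 'a vfield \<Rightarrow> 'a \<Rightarrow> real" where
  "F_tensor D P g x y z = g (deriv_P D P x y) z"

definition W3_manifold ::
    "('a::{t2_space,second_countable_topology}, 'n::finite) atlas \<Rightarrow> 'a tensor11 \<Rightarrow> 'a tensor02 \<Rightarrow> 'a connection \<Rightarrow> bool" where
  "W3_manifold A P g D \<longleftrightarrow> riemannian_almost_product A P g \<and>
     (\<forall>x\<in>vector_fields A. \<forall>y\<in>vector_fields A. \<forall>z\<in>vector_fields A.
        F_tensor D P g x y z + F_tensor D P g y z x + F_tensor D P g z x y = 0)"

definition P_manifold ::
    "('a::{t2_space,second_countable_topology}, 'n::finite) atlas \<Rightarrow> 'a tensor11 \<Rightarrow> 'a tensor02 \<Rightarrow> 'a connection \<Rightarrow> bool" where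
  "P_manifold A P g D \<longleftrightarrow> riemannian_almost_product A P g \<and>
     (\<forall>x\<in>vector_fields A. \<forall>y\<in>vector_fields A. deriv_P D P x y = 0)"

definition natural_connection ::
    "('a::{t2_space,second_countable_topology}, 'n::finite) atlas \<Rightarrow> 'a tensor11 \<Rightarrow> 'a tensor02 \<Rightarrow> 'a connection \<Rightarrow> bool" where
  "natural_connection A P g D' \<longleftrightarrow> linear_connection A D' \<and>
     (\<forall>x\<in>vector_fields A. \<forall>y\<in>vector_fields A. deriv_P D' P x y = 0) \<and>
     (\<forall>x\<in>vector_fields A. \<forall>y\<in>vector_fields A. \<forall>z\<in>vector_fields A. deriv_g D' g x y z = 0)"

definition canonical_connection ::
    "('a::{t2_space,second_countable_topology}, 'n::finite) atlas \<Rightarrow> 'a tensor11 \<Rightarrow> 'a tensor02 \<Rightarrow> 'a connection \<Rightarrow> bool" where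
  "canonical_connection A P g D' \<longleftrightarrow> natural_connection A P g D' \<and>
     (\<forall>x\<in>vector_fields A. \<forall>y\<in>vector_fields A. \<forall>z\<in>vector_fields A.
        g (torsion D' x y) z + g (torsion D' y z) x
        + g (torsion D' (P x) y) (P z) + g (torsion D' y (P z)) (P x) = 0)"

end

theory Submission
  imports Defs
begin

text \<open>
  Let \<open>Q = D' - D\<close>, let \<open>q x y z = g (Q x y) z\<close>, and let \<open>T\<close> be the torsion of the canonical connection
  \<open>D'\<close>, regarded as a tensor with three arguments. Because \<open>D\<close> and \<open>D'\<close> are both metric, \<open>q\<close> is skew in
  its last two arguments and is recovered from \<open>T\<close> (\<open>contorsion\<close>). On a \<open>W\<^sub>3\<close>-manifold the condition that
  singles out the canonical connection becomes \<open>T(Px, y) = T(x, Py) = -P T(x, y)\<close> (\<open>torsion_P\<close>): the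
  torsion vanishes on pairs from different eigenbundles of \<open>P\<close> and sends two vectors of one eigenbundle
  to the other eigenbundle.

  Everything else is a computation of \<open>\<tau>' - \<tau>\<close>. Substituting \<open>D = D' - Q\<close> in the curvature
  (\<open>curvature_difference\<close>) expresses \<open>R' - R\<close> by the covariant derivative of \<open>q\<close> along \<open>D'\<close> and by
  products of two factors \<open>Q\<close>. The form of the torsion gives \<open>q(Px, Px, z) = - q(x, x, z)\<close>, so the trace
  of \<open>q\<close> over its first two arguments is zero: the isometry \<open>P\<close> preserves the trace and changes its
  sign. The covariant derivative of \<open>q\<close> has the same symmetry, as \<open>P\<close> and \<open>g\<close> are parallel for \<open>D'\<close>;
  hence all derivative terms disappear from the scalar curvature, without any differentiation of frames.
  In an orthonormal basis of the tangent space the quadratic terms add up to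
  \<open>\<tau>' - \<tau> = (1/4) \<Sum> T(u\<^sub>i, u\<^sub>k, u\<^sub>l)\<^sup>2\<close> (\<open>scalar_curvature_difference\<close>), where the one remaining mixed
  sum \<open>\<Sum> T(u\<^sub>i, u\<^sub>k, u\<^sub>l) T(u\<^sub>k, u\<^sub>l, u\<^sub>i)\<close> vanishes, again because the isometry \<open>P\<close> changes its sign
  (\<open>torsion_cyclic_trace\<close>). Therefore \<open>\<tau>' = \<tau>\<close> exactly if \<open>T = 0\<close>, and \<open>T = 0\<close> exactly if
  \<open>\<nabla>P = 0\<close> (\<open>P_manifold_iff_torsion_free\<close>).

  Since vectors are derivations and tensors are \<open>C\<^sup>\<infinity>\<close>-multilinear maps on global vector fields, the
  contractions need the classical local theory first: a bump function and the Hadamard lemma yield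
  global vector fields that frame the tangent spaces near a given point (\<open>local_frame\<close>). From this
  follow the existence of the bases used for contractions (\<open>ex_basis_at\<close>) and the fact that a tensor at
  a point depends only on the values of its arguments there (\<open>tensorial_zero_at\<close>).
\<close>

section \<open>Calculus of \<open>C\<^sup>k\<close> maps\<close>

lemma frechet_derivative_cong_open:
  assumes "open S" "x \<in> S" "\<And>y. y \<in> S \<Longrightarrow> f y = g y"
  shows "frechet_derivative f (at x) = frechet_derivative g (at x)"
    and "f differentiable (at x) \<longleftrightarrow> g differentiable (at x)"
proof -
  have "(f has_derivative D) (at x) \<longleftrightarrow> (g has_derivative D) (at x)" for D
    using has_derivative_transform_within_open[OF _ assms(1,2), of f D UNIV g]
      has_derivative_transform_within_open[OF _ assms(1,2), of g D UNIV f] assms(3) by auto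
  then show "frechet_derivative f (at x) = frechet_derivative g (at x)"
    and "f differentiable (at x) \<longleftrightarrow> g differentiable (at x)"
    by (simp_all add: frechet_derivative_def differentiable_def)
qed

lemma Ck_on_cong:
  assumes "open S" "\<And>x. x \<in> S \<Longrightarrow> f x = g x"
  shows "Ck_on k f S \<longleftrightarrow> Ck_on k g S"
  using assms(2)
proof (induction k arbitrary: f g)
  case 0
  then show ?case by (simp cong: continuous_on_cong)
next
  case (Suc k)
  note eq = frechet_derivative_cong_open[OF assms(1) _ Suc.prems]
  have "Ck_on k (\<lambda>x. frechet_derivative f (at x) v) S
      \<longleftrightarrow> Ck_on k (\<lambda>x. frechet_derivative g (at x) v) S" for v
    by (rule Suc.IH) (simp add: eq(1))
  then show ?case using eq(2) by auto
qed

lemma Ck_on_SucI: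
  assumes "open S" "\<And>x. x \<in> S \<Longrightarrow> (f has_derivative f' x) (at x)"
    and "\<And>v. Ck_on k (\<lambda>x. f' x v) S"
  shows "Ck_on (Suc k) f S"
proof -
  have "Ck_on k (\<lambda>x. frechet_derivative f (at x) v) S" for v
    using assms(3)[of v] frechet_derivative_at[OF assms(2)]
    by (subst Ck_on_cong[OF assms(1), where g = "\<lambda>x. f' x v"]) (auto simp: fun_eq_iff)
  then show ?thesis using assms(2) by (auto simp: differentiable_def)
qed

lemma Ck_on_Suc_has_derivative:
  "Ck_on (Suc k) f S \<Longrightarrow> x \<in> S \<Longrightarrow> (f has_derivative frechet_derivative f (at x)) (at x)"
  by (simp add: frechet_derivative_works)

lemma Ck_on_SucD: "Ck_on (Suc k) f S \<Longrightarrow> Ck_on k f S"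
proof (induction k arbitrary: f)
  case 0
  then show ?case
    by (auto intro!: continuous_at_imp_continuous_on differentiable_imp_continuous_within)
next
  case (Suc k)
  then show ?case by (auto simp del: Ck_on.simps simp: Ck_on.simps(2)[of "Suc k"] Ck_on.simps(2)[of k f])
qed

lemma Ck_on_imp_continuous_on: "Ck_on k f S \<Longrightarrow> continuous_on S f"
proof (induction k)
  case (Suc k)
  then show ?case using Ck_on_SucD by blast
qed simp

lemma Ck_on_local:
  assumes "\<And>x. x \<in> S \<Longrightarrow> \<exists>T. open T \<and> x \<in> T \<and> Ck_on k f T"
  shows "Ck_on k f S"
  using assms
proof (induction k arbitrary: f)
  case 0
  show ?case unfolding Ck_on.simps
  proof (intro continuous_at_imp_continuous_on ballI)
    fix x assume "x \<in> S"
    then show "isCont f x" using 0[of x] continuous_on_eq_continuous_at[of _ f] by auto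
  qed
next
  case (Suc k)
  have "f differentiable (at x)" if "x \<in> S" for x using Suc.prems[OF that] by auto
  moreover have "Ck_on k (\<lambda>x. frechet_derivative f (at x) v) S" for v
    by (rule Suc.IH) (use Suc.prems in fastforce)
  ultimately show ?case by simp
qed

lemma Ck_on_subset: "Ck_on k f S \<Longrightarrow> T \<subseteq> S \<Longrightarrow> Ck_on k f T"
  by (induction k arbitrary: f) (auto intro: continuous_on_subset)

lemma Ck_on_const: "open S \<Longrightarrow> Ck_on k (\<lambda>_. c) S"
proof (induction k arbitrary: c)
  case (Suc k)
  then show ?case by (intro Ck_on_SucI[where f' = "\<lambda>_ _. 0"]) auto
qed simp

lemma Ck_on_bounded_linear:
  assumes "open S" "bounded_linear L" "Ck_on k f S"
  shows "Ck_on k (\<lambda>x. L (f x)) S"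
  using assms(3)
proof (induction k arbitrary: f)
  case 0
  then show ?case using bounded_linear.continuous_on[OF assms(2)] by simp
next
  case (Suc k)
  show ?case
  proof (rule Ck_on_SucI[OF assms(1)])
    show "((\<lambda>x. L (f x)) has_derivative (\<lambda>v. L (frechet_derivative f (at x) v))) (at x)" if "x \<in> S" for x
      using bounded_linear.has_derivative[OF assms(2) Ck_on_Suc_has_derivative[OF Suc.prems that]] .
    show "Ck_on k (\<lambda>x. L (frechet_derivative f (at x) v)) S" for v
      using Suc by simp
  qed
qed

lemma Ck_on_id: "open S \<Longrightarrow> Ck_on k (\<lambda>x. x) S"
proof (cases k)
  case (Suc j)
  assume "open S"
  then show ?thesis unfolding Suc
    by (intro Ck_on_SucI[where f' = "\<lambda>_ v. v"]) (auto intro: Ck_on_const)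
qed simp

lemma Ck_on_add:
  assumes "open S" "Ck_on k f S" "Ck_on k g S"
  shows "Ck_on k (\<lambda>x. f x + g x) S"
  using assms(2,3)
proof (induction k arbitrary: f g)
  case 0
  then show ?case by (simp add: continuous_on_add)
next
  case (Suc k)
  show ?case
    by (rule Ck_on_SucI[OF assms(1) has_derivative_add[OF Ck_on_Suc_has_derivative[OF Suc.prems(1)]
          Ck_on_Suc_has_derivative[OF Suc.prems(2)]]]) (use Suc in auto)
qed

lemma Ck_on_sum:
  assumes "open S" "\<And>i. i \<in> I \<Longrightarrow> Ck_on k (f i) S"
  shows "Ck_on k (\<lambda>x. \<Sum>i\<in>I. f i x) S"
  using assms(2) by (induction I rule: infinite_finite_induct) (auto intro: Ck_on_const Ck_on_add assms(1))

lemma Ck_on_bilinear: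
  assumes "open S" "bounded_bilinear b" "Ck_on k f S" "Ck_on k g S"
  shows "Ck_on k (\<lambda>x. b (f x) (g x)) S"
  using assms(3,4)
proof (induction k arbitrary: f g)
  case 0
  then show ?case using bounded_bilinear.continuous_on[OF assms(2)] by simp
next
  case (Suc k)
  show ?case
  proof (rule Ck_on_SucI[OF assms(1)])
    show "((\<lambda>x. b (f x) (g x)) has_derivative
        (\<lambda>v. b (f x) (frechet_derivative g (at x) v) + b (frechet_derivative f (at x) v) (g x))) (at x)"
      if "x \<in> S" for x
      using bounded_bilinear.FDERIV[OF assms(2) Ck_on_Suc_has_derivative[OF Suc.prems(1) that]
          Ck_on_Suc_has_derivative[OF Suc.prems(2) that]] .
    show "Ck_on k (\<lambda>x. b (f x) (frechet_derivative g (at x) v) + b (frechet_derivative f (at x) v) (g x)) S" for v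
      using Suc.prems Ck_on_SucD[OF Suc.prems(1)] Ck_on_SucD[OF Suc.prems(2)]
      by (intro Ck_on_add Suc.IH assms(1)) auto
  qed
qed

lemmas Ck_on_mult = Ck_on_bilinear[OF _ bounded_bilinear_mult]

text \<open>
  By the chain rule the derivative of the composition is a combination of the partial derivatives of the
  outer map, taken along the inner map, with the components of the derivative of the inner map as
  coefficients. All of these are one order less regular, so induction on the order applies to them.
\<close>

lemma Ck_on_compose:
  fixes f :: "'v::euclidean_space \<Rightarrow> 'w::real_normed_vector" and g :: "'u::real_normed_vector \<Rightarrow> 'v"
  assumes "open S" "open T" "Ck_on k f T" "Ck_on k g S" "g ` S \<subseteq> T"
  shows "Ck_on k (\<lambda>x. f (g x)) S"
  using assms(3,4)
proof (induction k arbitrary: f)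
  case 0
  then show ?case using continuous_on_compose2[of T f S g] assms(5) by simp
next
  case (Suc k)
  let ?f' = "\<lambda>x. frechet_derivative f (at x)" and ?g' = "\<lambda>x. frechet_derivative g (at x)"
  show ?case
  proof (rule Ck_on_SucI[OF assms(1)])
    fix x assume x: "x \<in> S"
    then have f: "(f has_derivative ?f' (g x)) (at (g x))"
      using Ck_on_Suc_has_derivative[OF Suc.prems(1)] assms(5) by auto
    have "?f' (g x) (?g' x v) = (\<Sum>i\<in>Basis. (?g' x v \<bullet> i) *\<^sub>R ?f' (g x) i)" for v
      by (subst (1) euclidean_representation[of "?g' x v", symmetric])
        (simp add: linear_sum[OF has_derivative_linear[OF f]] linear_scale[OF has_derivative_linear[OF f]])
    then show "((\<lambda>x. f (g x)) has_derivative (\<lambda>v. \<Sum>i\<in>Basis. (?g' x v \<bullet> i) *\<^sub>R ?f' (g x) i)) (at x)"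
      using has_derivative_compose[OF Ck_on_Suc_has_derivative[OF Suc.prems(2) x] f] by simp
  next
    fix v
    show "Ck_on k (\<lambda>x. \<Sum>i\<in>Basis. (?g' x v \<bullet> i) *\<^sub>R ?f' (g x) i) S"
    proof (intro Ck_on_sum Ck_on_bilinear[OF _ bounded_bilinear_scaleR] assms(1))
      fix i :: 'v
      show "Ck_on k (\<lambda>x. ?g' x v \<bullet> i) S"
        using Suc.prems(2) by (intro Ck_on_bounded_linear[OF assms(1) bounded_linear_inner_left]) auto
      show "Ck_on k (\<lambda>x. ?f' (g x) i) S"
        using Suc.prems(1) by (intro Suc.IH Ck_on_SucD[OF Suc.prems(2)]) auto
    qed
  qed
qed

section \<open>Bump functions and the Hadamard lemma\<close>

text \<open>
  The functions \<open>exp(-1/t) / t\<^sup>m\<close> are considered for all \<open>m\<close> at once because the derivative of one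
  of them is a combination of two others.
\<close>

definition flat :: "nat \<Rightarrow> real \<Rightarrow> real" where
  "flat m t = (if t > 0 then exp (- (1 / t)) / t ^ m else 0)"

lemma flat_tendsto_0: "(flat m \<longlongrightarrow> 0) (at 0)"
proof -
  have "((\<lambda>t::real. inverse t ^ m / exp (inverse t)) \<longlongrightarrow> 0) (at_right 0)"
    by (rule filterlim_compose[OF tendsto_power_div_exp_0 filterlim_inverse_at_top_right])
  then have "(flat m \<longlongrightarrow> 0) (at_right 0)"
    by (rule Lim_transform_eventually)
      (auto simp: flat_def eventually_at_filter field_simps exp_minus)
  moreover have "(flat m \<longlongrightarrow> 0) (at_left 0)"
    by (rule Lim_transform_eventually[OF tendsto_const])
      (auto simp: flat_def eventually_at_filter)
  ultimately show ?thesis by (simp add: filterlim_split_at)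
qed

lemma flat_has_derivative:
  "(flat m has_field_derivative flat (m + 2) t - m * flat (m + 1) t) (at t)"
proof -
  consider "t < 0" | "t = 0" | "t > 0" by linarith
  then show ?thesis
  proof cases
    case 1
    have "((\<lambda>_. 0::real) has_field_derivative 0) (at t)" by simp
    then have "(flat m has_field_derivative 0) (at t)"
      by (rule has_field_derivative_transform_within_open[of _ _ _ "{..<0}"]) (use 1 in \<open>auto simp: flat_def\<close>)
    then show ?thesis using 1 by (simp add: flat_def)
  next
    case 2
    have "((\<lambda>h. (flat m (0 + h) - flat m 0) / h) \<longlongrightarrow> 0) (at 0)"
      by (rule Lim_transform_eventually[OF flat_tendsto_0[of "Suc m"]])
        (auto simp: flat_def eventually_at_filter)
    then show ?thesis using 2 by (simp add: DERIV_def flat_def)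
  next
    case 3
    have "((\<lambda>t. exp (- (1 / t)) / t ^ m) has_field_derivative flat (m + 2) t - m * flat (m + 1) t) (at t)"
      using 3 power_minus_mult[of m t]
      by (cases "m = 0")
        (auto intro!: derivative_eq_intros simp: flat_def field_simps power2_eq_square)
    then show ?thesis
      by (rule has_field_derivative_transform_within_open[of _ _ _ "{0<..}"]) (use 3 in \<open>auto simp: flat_def\<close>)
  qed
qed

lemma Ck_on_flat: "Ck_on k (flat m) UNIV"
proof (induction k arbitrary: m)
  case 0
  show ?case
    using flat_has_derivative by (auto intro!: continuous_at_imp_continuous_on DERIV_isCont)
next
  case (Suc k)
  show ?case
  proof (rule Ck_on_SucI)
    show "(flat m has_derivative (*) (flat (m + 2) t - m * flat (m + 1) t)) (at t)" for t
      using flat_has_derivative by (simp add: has_field_derivative_def)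
    have "Ck_on k (\<lambda>x. v * flat (m + 2) x + (- v * m) * flat (m + 1) x) UNIV" for v
      by (intro Ck_on_add Ck_on_mult Ck_on_const Suc.IH) auto
    then show "Ck_on k (\<lambda>x. (flat (m + 2) x - m * flat (m + 1) x) * v) UNIV" for v
      by (simp add: algebra_simps)
  qed simp
qed

definition bump :: "'v::euclidean_space \<Rightarrow> real \<Rightarrow> 'v \<Rightarrow> real" where
  "bump a r x = flat 0 (r\<^sup>2 - (x - a) \<bullet> (x - a))"

lemma bump_eq_0_iff: "r > 0 \<Longrightarrow> bump a r x = 0 \<longleftrightarrow> x \<notin> ball a r"
  by (auto simp: bump_def flat_def dist_norm norm_minus_commute dot_square_norm not_less power_mono
      intro: power2_strict_mono dest: power2_less_imp_less)

lemma Ck_on_bump: "Ck_on k (bump a r) S"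
proof -
  have "Ck_on k (\<lambda>x. (x + - a) \<bullet> (x + - a)) UNIV"
    by (intro Ck_on_bilinear[OF _ bounded_bilinear_inner] Ck_on_add Ck_on_id Ck_on_const) auto
  then have "Ck_on k (\<lambda>x. r\<^sup>2 + (-1) * ((x + - a) \<bullet> (x + - a))) UNIV"
    by (intro Ck_on_add Ck_on_mult Ck_on_const) auto
  from Ck_on_compose[OF _ _ Ck_on_flat this] have "Ck_on k (\<lambda>x. flat 0 (r\<^sup>2 + (-1) * ((x + - a) \<bullet> (x + - a)))) UNIV"
    by simp
  then have "Ck_on k (bump a r) UNIV" by (simp add: bump_def[abs_def])
  then show ?thesis by (rule Ck_on_subset) simp
qed

text \<open>
  Differentiation in \<open>x\<close> under the integral sign replaces \<open>f\<close> by a directional derivative and produces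
  one more factor \<open>t\<close>; the power of \<open>t\<close> makes the statement stable under this step.
\<close>

lemma Ck_on_segment_integral:
  fixes f :: "'v::euclidean_space \<Rightarrow> real"
  assumes "open S" "convex S" "b \<in> S" "Ck_on k f S"
  shows "Ck_on k (\<lambda>x. integral {0..1} (\<lambda>t. t ^ m * f (b + t *\<^sub>R (x - b)))) S"
  using assms(4)
proof (induction k arbitrary: f m)
  case 0
  have seg: "b + t *\<^sub>R (x - b) \<in> S" if "x \<in> S" "t \<in> {0..1}" for x t
    using convexD_alt[OF assms(2,3) that(1)] that(2) by (simp add: algebra_simps)
  have "continuous_on (S \<times> {0..1}) (\<lambda>(x, t). t ^ m * f (b + t *\<^sub>R (x - b)))"
    unfolding split_beta using 0 seg
    by (auto intro!: continuous_intros continuous_on_compose2[of S f])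
  then show ?case
    using integral_continuous_on_param[of S 0 1 "\<lambda>x t. t ^ m * f (b + t *\<^sub>R (x - b))"] by simp
next
  case (Suc k)
  have seg: "b + t *\<^sub>R (x - b) \<in> S" if "x \<in> S" "t \<in> {0..1}" for x t
    using convexD_alt[OF assms(2,3) that(1)] that(2) by (simp add: algebra_simps)
  let ?f' = "\<lambda>x. frechet_derivative f (at x)"
  have lin: "bounded_linear (?f' x)" if "x \<in> S" for x
    using Ck_on_Suc_has_derivative[OF Suc.prems that] by (rule has_derivative_bounded_linear)
  have cf: "continuous_on S f"
    using Suc.prems by (auto intro!: continuous_at_imp_continuous_on differentiable_imp_continuous_within)
  have cf': "continuous_on S (\<lambda>x. ?f' x v)" for v
    using Suc.prems by (auto intro: Ck_on_imp_continuous_on)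
  let ?L = "\<lambda>x t. Blinfun (\<lambda>v. t ^ Suc m * ?f' (b + t *\<^sub>R (x - b)) v)"
  have L: "blinfun_apply (?L x t) v = t ^ Suc m * ?f' (b + t *\<^sub>R (x - b)) v"
    if "x \<in> S" "t \<in> {0..1}" for x t v
    by (subst bounded_linear_Blinfun_apply)
      (use lin[OF seg[OF that]] in \<open>auto intro: bounded_linear_const_mult\<close>)
  have cL: "continuous_on (S \<times> {0..1}) (\<lambda>(x, t). ?L x t)"
  proof (rule continuous_on_blinfun_componentwise)
    fix i :: 'v
    have "continuous_on (S \<times> {0..1}) (\<lambda>z. snd z ^ Suc m * ?f' (b + snd z *\<^sub>R (fst z - b)) i)"
      using seg by (auto intro!: continuous_intros continuous_on_compose2[OF cf'])
    then show "continuous_on (S \<times> {0..1}) (\<lambda>z. blinfun_apply (case z of (x, t) \<Rightarrow> ?L x t) i)"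
      by (rule continuous_on_eq) (auto simp: L simp del: power_Suc)
  qed
  have der: "((\<lambda>x. integral (cbox 0 1) (\<lambda>t. t ^ m * f (b + t *\<^sub>R (x - b)))) has_derivative
      blinfun_apply (integral (cbox 0 1) (?L x))) (at x within S)" if x: "x \<in> S" for x
  proof (rule leibniz_rule[OF _ _ _ x assms(2)])
    fix y and t :: real assume y: "y \<in> S" "t \<in> cbox 0 1"
    then have yt: "b + t *\<^sub>R (y - b) \<in> S" using seg by simp
    have "((\<lambda>x. t ^ m * f (b + t *\<^sub>R (x - b))) has_derivative
        (\<lambda>v. t ^ m * ?f' (b + t *\<^sub>R (y - b)) (t *\<^sub>R v))) (at y within S)"
      by (intro has_derivative_mult_right
          has_derivative_compose[where f = "\<lambda>x. b + t *\<^sub>R (x - b)" and x = y, OF _ Ck_on_Suc_has_derivative[OF Suc.prems yt]])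
        (auto intro!: derivative_eq_intros)
    moreover have "blinfun_apply (?L y t) = (\<lambda>v. t ^ m * ?f' (b + t *\<^sub>R (y - b)) (t *\<^sub>R v))"
      using L[of y t] y linear_scale[OF bounded_linear.linear[OF lin[OF yt]]] by (auto simp: fun_eq_iff)
    ultimately show "((\<lambda>x. t ^ m * f (b + t *\<^sub>R (x - b))) has_derivative blinfun_apply (?L y t)) (at y within S)"
      by simp
  next
    fix y assume y: "y \<in> S"
    show "(\<lambda>t. t ^ m * f (b + t *\<^sub>R (y - b))) integrable_on cbox 0 1"
      using y seg by (intro integrable_continuous)
        (auto intro!: continuous_intros continuous_on_compose2[OF cf])
  qed (use cL in simp)
  have Lint: "blinfun_apply (integral (cbox 0 1) (?L x)) v
      = integral {0..1} (\<lambda>t. t ^ Suc m * ?f' (b + t *\<^sub>R (x - b)) v)" if x: "x \<in> S" for x v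
  proof -
    have "continuous_on (cbox 0 1) (?L x)"
      using continuous_on_compose2[OF cL continuous_on_Pair[OF continuous_on_const continuous_on_id], of x "{0..1}"] x
      by auto
    then have "integral (cbox 0 1) (\<lambda>t. blinfun_apply (?L x t) v) = blinfun_apply (integral (cbox 0 1) (?L x)) v"
      using integral_linear[OF integrable_continuous blinfun.bounded_linear_left] unfolding o_def by blast
    moreover have "integral (cbox 0 1) (\<lambda>t. blinfun_apply (?L x t) v)
        = integral (cbox 0 1) (\<lambda>t. t ^ Suc m * ?f' (b + t *\<^sub>R (x - b)) v)"
      by (rule integral_cong) (use L x in auto)
    ultimately show ?thesis by simp
  qed
  show ?case
  proof (rule Ck_on_SucI[OF assms(1)])
    show "((\<lambda>x. integral {0..1} (\<lambda>t. t ^ m * f (b + t *\<^sub>R (x - b)))) has_derivative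
        (\<lambda>v. integral {0..1} (\<lambda>t. t ^ Suc m * ?f' (b + t *\<^sub>R (x - b)) v))) (at x)" if "x \<in> S" for x
      using has_derivative_eq_rhs[OF der[OF that] ext[OF Lint[OF that]]] at_within_open[OF that assms(1)]
      by simp
    show "Ck_on k (\<lambda>x. integral {0..1} (\<lambda>t. t ^ Suc m * ?f' (b + t *\<^sub>R (x - b)) v)) S" for v
      using Suc.prems by (intro Suc.IH) simp
  qed
qed

text \<open>
  This is the fundamental theorem of calculus for \<open>f\<close> along the segment from \<open>b\<close> to \<open>x\<close>. It determines
  derivations at \<open>b\<close>: they kill products of two functions that vanish at \<open>b\<close>.
\<close>

lemma hadamard:
  fixes f :: "real ^ 'n::finite \<Rightarrow> real"
  assumes S: "open S" "convex S" "b \<in> S" and f: "smooth_on f S"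
  obtains g where "\<And>i. smooth_on (g i) S"
    and "\<And>i. g i b = frechet_derivative f (at b) (axis i 1)"
    and "\<And>x. x \<in> S \<Longrightarrow> f x = f b + (\<Sum>i\<in>UNIV. (x $ i - b $ i) * g i x)"
proof
  let ?f' = "\<lambda>x. frechet_derivative f (at x)"
  let ?g = "\<lambda>i x. integral {0..1} (\<lambda>t. ?f' (b + t *\<^sub>R (x - b)) (axis i 1))"
  have f1: "Ck_on (Suc k) f S" for k using f by (auto simp: smooth_on_def)
  have f'1: "Ck_on k (\<lambda>x. ?f' x i) S" for k i using f1[of k] by simp
  have seg: "b + t *\<^sub>R (x - b) \<in> S" if "x \<in> S" "t \<in> {0..1}" for x t
    using convexD_alt[OF S(2,3) that(1)] that(2) by (simp add: algebra_simps)
  show "smooth_on (?g i) S" for i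
    unfolding smooth_on_def using Ck_on_segment_integral[OF S f'1, where m = 0] by simp
  show "?g i b = ?f' b (axis i 1)" for i by simp
  fix x assume x: "x \<in> S"
  have cf': "continuous_on S (\<lambda>x. ?f' x i)" for i
    using f1[of 0] by simp
  have "((\<lambda>t. ?f' (b + t *\<^sub>R (x - b)) (x - b)) has_integral f (b + 1 *\<^sub>R (x - b)) - f (b + 0 *\<^sub>R (x - b))) {0..1}"
  proof (rule fundamental_theorem_of_calculus)
    fix t :: real assume t: "t \<in> {0..1}"
    note d = Ck_on_Suc_has_derivative[OF f1 seg[OF x t]]
    have "((\<lambda>t. f (b + t *\<^sub>R (x - b))) has_derivative (\<lambda>s. ?f' (b + t *\<^sub>R (x - b)) (s *\<^sub>R (x - b)))) (at t within {0..1})"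
      by (rule has_derivative_compose[where f = "\<lambda>t. b + t *\<^sub>R (x - b)" and x = t, OF _ d]) (auto intro!: derivative_eq_intros)
    then show "((\<lambda>t. f (b + t *\<^sub>R (x - b))) has_vector_derivative ?f' (b + t *\<^sub>R (x - b)) (x - b)) (at t within {0..1})"
      using linear_scale[OF has_derivative_linear[OF d]] by (simp add: has_vector_derivative_def)
  qed simp
  then have "f x - f b = integral {0..1} (\<lambda>t. ?f' (b + t *\<^sub>R (x - b)) (x - b))"
    by (simp add: integral_unique)
  also have "\<dots> = integral {0..1} (\<lambda>t. \<Sum>i\<in>UNIV. (x $ i - b $ i) * ?f' (b + t *\<^sub>R (x - b)) (axis i 1))"
  proof (rule integral_cong)
    fix t :: real assume t: "t \<in> {0..1}"
    note lin = has_derivative_linear[OF Ck_on_Suc_has_derivative[OF f1 seg[OF x t]]]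
    show "?f' (b + t *\<^sub>R (x - b)) (x - b) = (\<Sum>i\<in>UNIV. (x $ i - b $ i) * ?f' (b + t *\<^sub>R (x - b)) (axis i 1))"
      by (subst (2) basis_expansion[of "x - b", symmetric])
        (simp add: scalar_mult_eq_scaleR linear_sum[OF lin] linear_scale[OF lin])
  qed
  also have "\<dots> = (\<Sum>i\<in>UNIV. (x $ i - b $ i) * ?g i x)"
    using x seg by (subst integral_sum)
      (auto intro!: integrable_continuous_interval continuous_intros continuous_on_compose2[OF cf'])
  finally show "f x = f b + (\<Sum>i\<in>UNIV. (x $ i - b $ i) * ?g i x)" by simp
qed

section \<open>Smooth functions and derivations on a manifold\<close>

lemma sum_fun_apply: "(\<Sum>i\<in>I. f i) x = (\<Sum>i\<in>I. f i x)"
  by (induction I rule: infinite_finite_induct) simp_all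

lemma smooth_on_subset: "smooth_on f S \<Longrightarrow> T \<subseteq> S \<Longrightarrow> smooth_on f T"
  unfolding smooth_on_def using Ck_on_subset by blast

lemma smooth_on_frechet_derivative: "smooth_on f S \<Longrightarrow> smooth_on (\<lambda>x. frechet_derivative f (at x) v) S"
  unfolding smooth_on_def using Ck_on.simps(2) by blast

lemma smooth_on_mult:
  fixes f g :: "'v::real_normed_vector \<Rightarrow> real"
  shows "open S \<Longrightarrow> smooth_on f S \<Longrightarrow> smooth_on g S \<Longrightarrow> smooth_on (\<lambda>x. f x * g x) S"
  unfolding smooth_on_def by (auto intro: Ck_on_mult)

lemma smooth_on_extend_zero:
  assumes "smooth_on h W" "open W" "closed K" "K \<subseteq> W" "\<And>x. x \<notin> K \<Longrightarrow> h x = 0"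
  shows "smooth_on h S"
  unfolding smooth_on_def
proof
  fix k
  have "Ck_on k h (- K)"
    using Ck_on_cong[of "- K" h "\<lambda>_. 0" k] Ck_on_const[of "- K" k 0] assms(3,5) by auto
  moreover have "Ck_on k h W" using assms(1) by (simp add: smooth_on_def)
  ultimately have "Ck_on k h UNIV"
    using assms(2,3,4) by (intro Ck_on_local) (metis ComplI UNIV_I open_Compl subsetD)
  then show "Ck_on k h S" by (rule Ck_on_subset) simp
qed

lemma chartD:
  assumes "smooth_manifold A" "(U, \<phi>) \<in> A"
  shows "open U" "open (\<phi> ` U)" "homeomorphism U (\<phi> ` U) \<phi> (inv_into U \<phi>)"
    and "q \<in> U \<Longrightarrow> inv_into U \<phi> (\<phi> q) = q"
proof -
  have *: "open U \<and> open (\<phi> ` U) \<and> homeomorphism U (\<phi> ` U) \<phi> (inv_into U \<phi>)"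
    using assms unfolding smooth_manifold_def by blast
  then show "open U" "open (\<phi> ` U)" "homeomorphism U (\<phi> ` U) \<phi> (inv_into U \<phi>)" by auto
  show "q \<in> U \<Longrightarrow> inv_into U \<phi> (\<phi> q) = q" using * by (simp add: homeomorphism_def)
qed

lemma CinfI:
  "(\<And>U \<phi> k. (U, \<phi>) \<in> A \<Longrightarrow> Ck_on k (f \<circ> inv_into U \<phi>) (\<phi> ` U)) \<Longrightarrow> f \<in> Cinf A"
  unfolding Cinf_def smooth_on_def by blast

lemma CinfD: "f \<in> Cinf A \<Longrightarrow> (U, \<phi>) \<in> A \<Longrightarrow> Ck_on k (f \<circ> inv_into U \<phi>) (\<phi> ` U)"
  unfolding Cinf_def smooth_on_def by blast

lemma Cinf_add:
  assumes "smooth_manifold A" "f \<in> Cinf A" "h \<in> Cinf A"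
  shows "f + h \<in> Cinf A"
proof (rule CinfI)
  fix U \<phi> k assume U: "(U, \<phi>) \<in> A"
  show "Ck_on k ((f + h) \<circ> inv_into U \<phi>) (\<phi> ` U)"
    using Ck_on_add[OF chartD(2)[OF assms(1) U] CinfD[OF assms(2) U] CinfD[OF assms(3) U]]
    by (simp add: o_def)
qed

lemma Cinf_mult:
  assumes "smooth_manifold A" "f \<in> Cinf A" "h \<in> Cinf A"
  shows "f * h \<in> Cinf A"
proof (rule CinfI)
  fix U \<phi> k assume U: "(U, \<phi>) \<in> A"
  show "Ck_on k ((f * h) \<circ> inv_into U \<phi>) (\<phi> ` U)"
    using Ck_on_mult[OF chartD(2)[OF assms(1) U] CinfD[OF assms(2) U] CinfD[OF assms(3) U]]
    by (simp add: o_def)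
qed

lemma Cinf_const:
  assumes "smooth_manifold A"
  shows "(\<lambda>_. c) \<in> Cinf A"
  by (rule CinfI) (simp add: o_def Ck_on_const chartD(2)[OF assms])

lemma Cinf_scale: "smooth_manifold A \<Longrightarrow> f \<in> Cinf A \<Longrightarrow> (\<lambda>q. c * f q) \<in> Cinf A"
  using Cinf_mult[OF _ Cinf_const, of A f c] by (simp add: times_fun_def mult.commute)

lemma Cinf_sum: "smooth_manifold A \<Longrightarrow> (\<And>i. i \<in> I \<Longrightarrow> f i \<in> Cinf A) \<Longrightarrow> (\<Sum>i\<in>I. f i) \<in> Cinf A"
proof (induction I rule: infinite_finite_induct)
  case (insert x F)
  then show ?case unfolding sum.insert[OF insert.hyps] by (intro Cinf_add) auto
qed (simp_all add: zero_fun_def Cinf_const)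

lemma tangent_spaceD:
  assumes "v \<in> tangent_space A p"
  shows "f \<notin> Cinf A \<Longrightarrow> v f = 0"
    and "f \<in> Cinf A \<Longrightarrow> h \<in> Cinf A \<Longrightarrow> v (f + h) = v f + v h"
    and "f \<in> Cinf A \<Longrightarrow> v (\<lambda>q. c * f q) = c * v f"
    and "f \<in> Cinf A \<Longrightarrow> h \<in> Cinf A \<Longrightarrow> v (f * h) = f p * v h + h p * v f"
  using assms by (simp_all add: tangent_space_def)

lemma tangent_const:
  assumes "smooth_manifold A" "v \<in> tangent_space A p"
  shows "v (\<lambda>_. c) = 0"
proof -
  have "v ((\<lambda>_. 1) * (\<lambda>_. 1)) = v (\<lambda>_. 1) + v (\<lambda>_. 1)"
    using tangent_spaceD(4)[OF assms(2) Cinf_const Cinf_const, OF assms(1,1)] by simp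
  then have "v (\<lambda>_. 1) = 0" by (simp add: times_fun_def)
  then show ?thesis
    using tangent_spaceD(3)[OF assms(2) Cinf_const[OF assms(1)], of c 1] by simp
qed

lemma tangent_sum:
  assumes "smooth_manifold A" "v \<in> tangent_space A p" "\<And>i. i \<in> I \<Longrightarrow> f i \<in> Cinf A"
  shows "v (\<Sum>i\<in>I. f i) = (\<Sum>i\<in>I. v (f i))"
  using assms(3)
proof (induction I rule: infinite_finite_induct)
  case (insert x F)
  then show ?case
    unfolding sum.insert[OF insert.hyps]
    by (subst tangent_spaceD(2)[OF assms(2)]) (auto intro: Cinf_sum[OF assms(1)])
qed (use tangent_const[OF assms(1,2), of 0] in \<open>simp_all add: zero_fun_def\<close>)

definition chart_ext :: "'a set \<Rightarrow> ('a \<Rightarrow> 'v) \<Rightarrow> ('v \<Rightarrow> real) \<Rightarrow> 'a \<Rightarrow> real" where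
  "chart_ext U \<phi> h q = (if q \<in> U then h (\<phi> q) else 0)"

lemma open_chart_image:
  assumes "smooth_manifold A" "(U, \<phi>) \<in> A" "open V" "V \<subseteq> U"
  shows "open (\<phi> ` V)"
proof -
  note c = chartD[OF assms(1,2)]
  have "openin (top_of_set U) V" using assms(3,4) openin_open_eq[OF c(1)] by blast
  then have "openin (top_of_set (\<phi> ` U)) (\<phi> ` V)"
    by (rule homeomorphism_imp_open_map[OF c(3)])
  then show ?thesis using openin_open_eq[OF c(2)] by blast
qed

text \<open>
  The preimage of \<open>K\<close> is compact, hence closed because the space is Hausdorff. So the chart domain and
  the complement of this preimage are two open sets that cover the manifold; the extension is smooth on the
  first by composition with coordinate changes, and zero on the second.
\<close>

lemma chart_ext_in_Cinf:
  fixes A :: "('a::{t2_space,second_countable_topology}, 'n::finite) atlas"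
  assumes A: "smooth_manifold A" and U: "(U, \<phi>) \<in> A"
    and h: "smooth_on h W" "open W" "compact K" "K \<subseteq> W" "W \<subseteq> \<phi> ` U" "\<And>x. x \<notin> K \<Longrightarrow> h x = 0"
  shows "chart_ext U \<phi> h \<in> Cinf A"
proof -
  note cU = chartD[OF A U]
  define C where "C = inv_into U \<phi> ` K"
  have "compact C"
    unfolding C_def
  proof (rule compact_continuous_image[OF _ h(3)])
    have "continuous_on (\<phi> ` U) (inv_into U \<phi>)" using cU(3) unfolding homeomorphism_def by blast
    then show "continuous_on K (inv_into U \<phi>)" using h(4,5) by (auto intro: continuous_on_subset)
  qed
  then have C: "closed C" by (rule compact_imp_closed)
  have h': "Ck_on k h UNIV" for k
    using smooth_on_extend_zero[OF h(1,2) compact_imp_closed[OF h(3)] h(4,6)] by (simp add: smooth_on_def)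
  have "Ck_on k (chart_ext U \<phi> h \<circ> inv_into V \<psi>) (\<psi> ` V)" if V: "(V, \<psi>) \<in> A" for V \<psi> k
  proof (rule Ck_on_local)
    note cV = chartD[OF A V]
    fix x assume "x \<in> \<psi> ` V"
    then obtain q where q: "q \<in> V" "x = \<psi> q" by auto
    show "\<exists>T. open T \<and> x \<in> T \<and> Ck_on k (chart_ext U \<phi> h \<circ> inv_into V \<psi>) T"
    proof (cases "q \<in> U")
      case True
      let ?T = "\<psi> ` (V \<inter> U)"
      have T: "open ?T" by (rule open_chart_image[OF A V]) (use cU cV in auto)
      have "smooth_on (\<phi> \<circ> inv_into V \<psi>) ?T" using A U V by (fastforce simp: smooth_manifold_def)
      then have "Ck_on k (\<lambda>x. h ((\<phi> \<circ> inv_into V \<psi>) x)) ?T"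
        using T by (intro Ck_on_compose[OF _ _ h']) (auto simp: smooth_on_def o_def)
      then have "Ck_on k (chart_ext U \<phi> h \<circ> inv_into V \<psi>) ?T"
        by (subst Ck_on_cong[OF T, where g = "\<lambda>x. h ((\<phi> \<circ> inv_into V \<psi>) x)"])
          (auto simp: chart_ext_def cV)
      then show ?thesis using T q True by blast
    next
      case False
      let ?T = "\<psi> ` (V - C)"
      have T: "open ?T" by (rule open_chart_image[OF A V]) (use C cV in auto)
      have "\<phi> q' \<notin> K" if "q' \<notin> C" "q' \<in> U" for q'
        using that cU(4)[of q'] unfolding C_def by (metis image_eqI)
      then have "Ck_on k (chart_ext U \<phi> h \<circ> inv_into V \<psi>) ?T"
        using h(6) by (subst Ck_on_cong[OF T, where g = "\<lambda>_. 0"])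
          (auto simp: chart_ext_def cV Ck_on_const[OF T])
      moreover have "C \<subseteq> U" unfolding C_def using h(4,5) by (auto simp: cU(4))
      ultimately show ?thesis using T q False by blast
    qed
  qed
  then show ?thesis by (auto simp: Cinf_def smooth_on_def)
qed

text \<open>
  The coordinate field \<open>\<partial>\<^sub>i\<close> of a chart, cut off by \<open>\<beta>\<close>, with value 0 on non-smooth functions as for
  every vector field here.
\<close>

definition chart_frame ::
    "('a::{t2_space,second_countable_topology}, 'n::finite) atlas \<Rightarrow> 'a set \<Rightarrow> ('a \<Rightarrow> real ^ 'n)
      \<Rightarrow> (real ^ 'n \<Rightarrow> real) \<Rightarrow> 'n \<Rightarrow> 'a vfield" where
  "chart_frame A U \<phi> \<beta> i f =
     (if f \<in> Cinf A
      then chart_ext U \<phi> (\<lambda>x. \<beta> x * frechet_derivative (f \<circ> inv_into U \<phi>) (at x) (axis i 1)) else 0)"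

lemma chart_frame_in_vector_fields:
  fixes A :: "('a::{t2_space,second_countable_topology}, 'n::finite) atlas"
  assumes A: "smooth_manifold A" and U: "(U, \<phi>) \<in> A"
    and \<beta>: "smooth_on \<beta> (\<phi> ` U)" "compact K" "K \<subseteq> \<phi> ` U" "\<And>x. x \<notin> K \<Longrightarrow> \<beta> x = 0"
  shows "chart_frame A U \<phi> \<beta> i \<in> vector_fields A"
proof -
  let ?E = "chart_frame A U \<phi> \<beta> i"
  note cU = chartD[OF A U]
  have der: "((f \<circ> inv_into U \<phi>) has_derivative frechet_derivative (f \<circ> inv_into U \<phi>) (at (\<phi> q))) (at (\<phi> q))"
    if "f \<in> Cinf A" "q \<in> U" for f q
    by (rule Ck_on_Suc_has_derivative[OF CinfD[OF that(1) U]]) (use that in auto)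
  have "?E f \<in> Cinf A" if f: "f \<in> Cinf A" for f
  proof -
    have "smooth_on (f \<circ> inv_into U \<phi>) (\<phi> ` U)" using CinfD[OF f U] by (simp add: smooth_on_def)
    then have "smooth_on (\<lambda>x. \<beta> x * frechet_derivative (f \<circ> inv_into U \<phi>) (at x) (axis i 1)) (\<phi> ` U)"
      by (intro smooth_on_mult smooth_on_frechet_derivative \<beta>(1) cU(2))
    then show ?thesis using f \<beta> cU(2) by (simp add: chart_frame_def chart_ext_in_Cinf[OF A U])
  qed
  moreover have "(\<lambda>f. ?E f q) \<in> tangent_space A q" for q
  proof (cases "q \<in> U")
    case False
    then show ?thesis by (simp add: tangent_space_def chart_frame_def chart_ext_def)
  next
    case q: True
    have val: "?E f q = \<beta> (\<phi> q) * frechet_derivative (f \<circ> inv_into U \<phi>) (at (\<phi> q)) (axis i 1)"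
      if "f \<in> Cinf A" for f
      using that q by (simp add: chart_frame_def chart_ext_def)
    show ?thesis unfolding tangent_space_def
    proof (intro CollectI conjI ballI allI impI)
      show "?E f q = 0" if "f \<notin> Cinf A" for f using that by (simp add: chart_frame_def)
    next
      fix f h assume f: "f \<in> Cinf A" and h: "h \<in> Cinf A"
      have "frechet_derivative ((f + h) \<circ> inv_into U \<phi>) (at (\<phi> q))
          = (\<lambda>v. frechet_derivative (f \<circ> inv_into U \<phi>) (at (\<phi> q)) v + frechet_derivative (h \<circ> inv_into U \<phi>) (at (\<phi> q)) v)"
        by (rule frechet_derivative_at[symmetric])
          (use has_derivative_add[OF der[OF f q] der[OF h q]] in \<open>simp add: o_def\<close>)
      then show "?E (f + h) q = ?E f q + ?E h q"
        by (simp add: val[OF f] val[OF h] val[OF Cinf_add[OF A f h]] algebra_simps)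
      have "frechet_derivative ((f * h) \<circ> inv_into U \<phi>) (at (\<phi> q))
          = (\<lambda>v. f q * frechet_derivative (h \<circ> inv_into U \<phi>) (at (\<phi> q)) v
               + frechet_derivative (f \<circ> inv_into U \<phi>) (at (\<phi> q)) v * h q)"
        by (rule frechet_derivative_at[symmetric])
          (use has_derivative_mult[OF der[OF f q] der[OF h q]] in \<open>simp add: o_def cU(4)[OF q]\<close>)
      then show "?E (f * h) q = f q * ?E h q + h q * ?E f q"
        by (simp add: val[OF f] val[OF h] val[OF Cinf_mult[OF A f h]] algebra_simps)
    next
      fix c f assume f: "f \<in> Cinf A"
      have "frechet_derivative ((\<lambda>q. c * f q) \<circ> inv_into U \<phi>) (at (\<phi> q))
          = (\<lambda>v. c * frechet_derivative (f \<circ> inv_into U \<phi>) (at (\<phi> q)) v)"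
        by (rule frechet_derivative_at[symmetric])
          (use has_derivative_mult_right[OF der[OF f q], of c] in \<open>simp add: o_def\<close>)
      then show "?E (\<lambda>q. c * f q) q = c * ?E f q"
        by (simp add: val[OF f] val[OF Cinf_scale[OF A f]])
    qed
  qed
  ultimately show ?thesis by (simp add: vector_fields_def)
qed

text \<open>
  In a chart take a bump function \<open>b\<close> around \<open>p\<close>, \<open>E i = b \<partial>\<^sub>i\<close> and \<open>c i = b x\<^sub>i\<close>, all extended by zero. For
  a point \<open>q\<close> of the ball with coordinates \<open>y\<close>, the Hadamard lemma times \<open>b\<^sup>2\<close> is the global identity
  \<open>b\<^sup>2 f = f(q) b\<^sup>2 + \<Sum> (c i - y\<^sub>i b) (b g\<^sub>i)\<close>. Applying a derivation \<open>v\<close> at \<open>q\<close>, where \<open>c i - y\<^sub>i b\<close>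
  vanishes, expresses \<open>v f\<close> by the \<open>E i f\<close>. With the factor \<open>b\<^sup>3\<close> the coefficients are smooth global
  expressions, and the formula stays true outside the ball, where both sides are 0.
\<close>

lemma local_frame:
  fixes A :: "('a::{t2_space,second_countable_topology}, 'n::finite) atlas"
  assumes A: "smooth_manifold A"
  obtains E :: "'n \<Rightarrow> 'a vfield" and b :: "'a \<Rightarrow> real" and c :: "'n \<Rightarrow> 'a \<Rightarrow> real"
  where "\<And>i. E i \<in> vector_fields A" "b \<in> Cinf A" "\<And>i. c i \<in> Cinf A" "b p \<noteq> 0"
    and "\<And>q v f. v \<in> tangent_space A q
        \<Longrightarrow> b q ^ 3 * v f = (\<Sum>i\<in>UNIV. (b q * v (c i) - c i q * v b) * E i f q)"
    and "\<And>i j. b p * E i (c j) p - c j p * E i b p = (if i = j then b p ^ 3 else 0)"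
proof -
  have "p \<in> (\<Union>(U, \<phi>)\<in>A. U)" using A by (simp add: smooth_manifold_def)
  then obtain U and \<phi> :: "'a \<Rightarrow> real ^ 'n" where U: "(U, \<phi>) \<in> A" and p: "p \<in> U" by auto
  note cU = chartD[OF A U]
  obtain R where R: "R > 0" "ball (\<phi> p) R \<subseteq> \<phi> ` U"
    using cU(2) p by (meson image_eqI open_contains_ball)
  define r where "r = R / 2"
  define \<beta> where "\<beta> = bump (\<phi> p) r"
  have r: "r > 0" "cball (\<phi> p) r \<subseteq> ball (\<phi> p) R" using R(1) by (auto simp: r_def)
  have \<beta>s: "smooth_on \<beta> S" for S by (simp add: \<beta>_def smooth_on_def Ck_on_bump)
  have \<beta>0: "\<beta> x = 0 \<longleftrightarrow> x \<notin> ball (\<phi> p) r" for x by (simp add: \<beta>_def bump_eq_0_iff[OF r(1)])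
  have \<beta>c: "x \<notin> cball (\<phi> p) r \<Longrightarrow> \<beta> x = 0" for x using \<beta>0[of x] by auto
  have ext: "chart_ext U \<phi> (\<lambda>x. \<beta> x * h x) \<in> Cinf A" if "smooth_on h (ball (\<phi> p) R)" for h
    by (rule chart_ext_in_Cinf[OF A U smooth_on_mult[OF open_ball \<beta>s that] open_ball compact_cball r(2) R(2)])
      (simp add: \<beta>c)
  define b where "b = chart_ext U \<phi> (\<lambda>x. \<beta> x * 1)"
  define c where "c i = chart_ext U \<phi> (\<lambda>x. \<beta> x * x $ i)" for i
  define E where "E = chart_frame A U \<phi> \<beta>"
  have E: "E i \<in> vector_fields A" for i
    unfolding E_def by (rule chart_frame_in_vector_fields[OF A U \<beta>s compact_cball _ \<beta>c]) (use r R in auto)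
  have proj: "smooth_on (\<lambda>x :: real ^ 'n. x $ i) S" if "open S" for i S
    unfolding smooth_on_def using Ck_on_bounded_linear[OF that bounded_linear_vec_nth Ck_on_id[OF that]] by blast
  have bC: "b \<in> Cinf A" unfolding b_def by (rule ext) (simp add: smooth_on_def Ck_on_const)
  have cC: "c i \<in> Cinf A" for i unfolding c_def by (rule ext[OF proj]) simp
  have bp: "b p \<noteq> 0" using p r by (simp add: b_def chart_ext_def \<beta>0)
  have span: "b q ^ 3 * v f = (\<Sum>i\<in>UNIV. (b q * v (c i) - c i q * v b) * E i f q)"
    if v: "v \<in> tangent_space A q" for q v f
  proof -
    consider "f \<notin> Cinf A" | "b q = 0" | "f \<in> Cinf A" "b q \<noteq> 0" by blast
    then show ?thesis
    proof cases
      case 1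
      then show ?thesis using tangent_spaceD(1)[OF v] by (simp add: E_def chart_frame_def)
    next
      case 2
      then have "c i q = 0" for i by (auto simp: b_def c_def chart_ext_def split: if_splits)
      then show ?thesis using 2 by simp
    next
      case 3
      note vD = tangent_spaceD[OF v]
      have q: "q \<in> U" "\<phi> q \<in> ball (\<phi> p) r" using 3(2) \<beta>0 by (auto simp: b_def chart_ext_def split: if_splits)
      then have qR: "\<phi> q \<in> ball (\<phi> p) R" using r(2) ball_subset_cball by blast
      let ?f = "f \<circ> inv_into U \<phi>"
      have "smooth_on ?f (\<phi> ` U)" using CinfD[OF 3(1) U] by (simp add: smooth_on_def)
      then have "smooth_on ?f (ball (\<phi> p) R)" using R(2) by (rule smooth_on_subset)
      then obtain g where g: "\<And>i. smooth_on (g i) (ball (\<phi> p) R)"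
        "\<And>i. g i (\<phi> q) = frechet_derivative ?f (at (\<phi> q)) (axis i 1)"
        "\<And>x. x \<in> ball (\<phi> p) R \<Longrightarrow> ?f x = ?f (\<phi> q) + (\<Sum>i\<in>UNIV. (x $ i - \<phi> q $ i) * g i x)"
        using hadamard[OF open_ball convex_ball qR] by blast
      define G where "G i = chart_ext U \<phi> (\<lambda>x. \<beta> x * g i x)" for i
      define u where "u i = c i + (\<lambda>x. (- (\<phi> q $ i)) * b x)" for i
      have GC: "G i \<in> Cinf A" for i unfolding G_def by (rule ext[OF g(1)])
      have uC: "u i \<in> Cinf A" for i unfolding u_def by (intro Cinf_add Cinf_scale A cC bC)
      have bb: "b * b \<in> Cinf A" and bf: "b * f \<in> Cinf A" by (intro Cinf_mult A bC 3(1))+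
      have "b * (b * f) = (\<lambda>x. f q * (b * b) x) + (\<Sum>i\<in>UNIV. u i * G i)"
      proof
        fix x
        show "(b * (b * f)) x = ((\<lambda>x. f q * (b * b) x) + (\<Sum>i\<in>UNIV. u i * G i)) x"
        proof (cases "x \<in> U \<and> \<phi> x \<in> ball (\<phi> p) R")
          case True
          then have f: "f x = f q + (\<Sum>i\<in>UNIV. (\<phi> x $ i - \<phi> q $ i) * g i (\<phi> x))"
            using g(3)[of "\<phi> x"] cU(4) q(1) by simp
          have "(u i * G i) x = b x * (b x * ((\<phi> x $ i - \<phi> q $ i) * g i (\<phi> x)))" for i
            using True by (simp add: u_def b_def c_def G_def chart_ext_def algebra_simps)
          then show ?thesis
            by (simp add: sum_fun_apply f distrib_left sum_distrib_left)
        next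
          case False
          then have "x \<notin> U \<or> \<beta> (\<phi> x) = 0" using \<beta>c[of "\<phi> x"] r(2) by blast
          then have "b x = 0" "\<And>i. G i x = 0" by (auto simp: b_def G_def chart_ext_def)
          then show ?thesis by (simp add: sum_fun_apply)
        qed
      qed
      then have "v (b * (b * f)) = v ((\<lambda>x. f q * (b * b) x) + (\<Sum>i\<in>UNIV. u i * G i))" by simp
      also have "\<dots> = f q * v (b * b) + (\<Sum>i\<in>UNIV. v (u i * G i))"
        unfolding vD(2)[OF Cinf_scale[OF A bb] Cinf_sum[OF A Cinf_mult[OF A uC GC]]] vD(3)[OF bb]
          tangent_sum[OF A v Cinf_mult[OF A uC GC]] ..
      also have "\<dots> = f q * (2 * b q * v b) + (\<Sum>i\<in>UNIV. G i q * (v (c i) - \<phi> q $ i * v b))"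
      proof -
        \<comment> \<open>At \<open>q\<close> the product rule leaves only the terms that differentiate \<open>u i\<close>, as \<open>u i\<close> vanishes there.\<close>
        have "u i q = 0" for i using q by (simp add: u_def c_def b_def chart_ext_def)
        moreover have "v (u i) = v (c i) - \<phi> q $ i * v b" for i
          unfolding u_def vD(2)[OF cC Cinf_scale[OF A bC]] vD(3)[OF bC] by simp
        ultimately show ?thesis by (simp add: vD(4) bC uC GC)
      qed
      finally have "b q * (b q * v f) = (\<Sum>i\<in>UNIV. G i q * (v (c i) - \<phi> q $ i * v b))"
        by (simp add: vD(4) bC bf 3(1) algebra_simps)
      then have "b q ^ 3 * v f = (\<Sum>i\<in>UNIV. b q * (G i q * (v (c i) - \<phi> q $ i * v b)))"
        by (simp add: power3_eq_cube sum_distrib_left[symmetric])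
      also have "\<dots> = (\<Sum>i\<in>UNIV. (b q * v (c i) - c i q * v b) * E i f q)"
        using q 3(1) g(2) by (intro sum.cong)
          (auto simp: E_def chart_frame_def G_def b_def c_def chart_ext_def algebra_simps)
      finally show ?thesis .
    qed
  qed
  have dual: "b p * E i (c j) p - c j p * E i b p = (if i = j then b p ^ 3 else 0)" for i j
  proof -
    let ?y = "\<phi> p"
    have y: "?y \<in> \<phi> ` U" using p by simp
    have d\<beta>: "(\<beta> has_derivative frechet_derivative \<beta> (at ?y)) (at ?y)"
      by (rule Ck_on_Suc_has_derivative[of 0 _ UNIV]) (use \<beta>s[of UNIV] in \<open>simp_all add: smooth_on_def del: Ck_on.simps\<close>)
    have "frechet_derivative (b \<circ> inv_into U \<phi>) (at ?y) = frechet_derivative \<beta> (at ?y)"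
      by (rule frechet_derivative_cong_open(1)[OF cU(2) y]) (auto simp: b_def chart_ext_def cU(4))
    moreover have "frechet_derivative (c j \<circ> inv_into U \<phi>) (at ?y)
        = frechet_derivative (\<lambda>x. \<beta> x * x $ j) (at ?y)"
      by (rule frechet_derivative_cong_open(1)[OF cU(2) y]) (auto simp: c_def chart_ext_def cU(4))
    moreover have "frechet_derivative (\<lambda>x. \<beta> x * x $ j) (at ?y)
        = (\<lambda>v. \<beta> ?y * v $ j + frechet_derivative \<beta> (at ?y) v * ?y $ j)"
      by (rule frechet_derivative_at[symmetric])
        (rule has_derivative_mult[OF d\<beta> bounded_linear.has_derivative[OF bounded_linear_vec_nth has_derivative_ident]])
    ultimately show ?thesis
      using p bC cC by (simp add: E_def chart_frame_def chart_ext_def b_def[THEN fun_cong, of p] c_def[THEN fun_cong, of j p]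
          axis_def power3_eq_cube algebra_simps)
  qed
  show ?thesis by (rule that[OF E bC cC bp span dual])
qed

section \<open>Vector fields, bases and tensors at a point\<close>

lemma vector_fields_iff:
  "x \<in> vector_fields A \<longleftrightarrow>
    (\<forall>f\<in>Cinf A. x f \<in> Cinf A) \<and> (\<forall>f. f \<notin> Cinf A \<longrightarrow> x f = 0) \<and>
    (\<forall>f\<in>Cinf A. \<forall>h\<in>Cinf A. x (f + h) = x f + x h) \<and>
    (\<forall>c. \<forall>f\<in>Cinf A. x (\<lambda>q. c * f q) = (\<lambda>q. c * x f q)) \<and>
    (\<forall>f\<in>Cinf A. \<forall>h\<in>Cinf A. x (f * h) = f * x h + h * x f)"
  unfolding vector_fields_def tangent_space_def fun_eq_iff mem_Collect_eq
    plus_fun_apply times_fun_apply zero_fun_apply by blast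

lemma vector_fieldsD:
  assumes "x \<in> vector_fields A"
  shows "f \<in> Cinf A \<Longrightarrow> x f \<in> Cinf A"
    and "f \<notin> Cinf A \<Longrightarrow> x f = 0"
    and "f \<in> Cinf A \<Longrightarrow> h \<in> Cinf A \<Longrightarrow> x (f + h) = x f + x h"
    and "f \<in> Cinf A \<Longrightarrow> x (\<lambda>q. c * f q) = (\<lambda>q. c * x f q)"
    and "f \<in> Cinf A \<Longrightarrow> h \<in> Cinf A \<Longrightarrow> x (f * h) = f * x h + h * x f"
    and "(\<lambda>f. x f p) \<in> tangent_space A p"
  using assms unfolding vector_fields_iff apply blast+
  using assms unfolding vector_fields_def by blast

lemma vector_field_const:
  "smooth_manifold A \<Longrightarrow> x \<in> vector_fields A \<Longrightarrow> x (\<lambda>_. c) = 0"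
  using tangent_const[OF _ vector_fieldsD(6)] by (auto simp: fun_eq_iff)

lemma Cinf_diff:
  assumes "smooth_manifold A" "f \<in> Cinf A" "h \<in> Cinf A"
  shows "f - h \<in> Cinf A"
proof -
  have eq: "f - h = f + (\<lambda>q. (-1) * h q)" by (simp add: fun_eq_iff)
  show ?thesis unfolding eq by (rule Cinf_add[OF assms(1,2) Cinf_scale[OF assms(1,3)]])
qed

lemma vf_add:
  assumes "smooth_manifold A" "x \<in> vector_fields A" "y \<in> vector_fields A"
  shows "x + y \<in> vector_fields A"
  unfolding vector_fields_iff using vector_fieldsD[OF assms(2)] vector_fieldsD[OF assms(3)] Cinf_add[OF assms(1)]
  by (auto simp: algebra_simps)

lemma vf_smult:
  assumes "smooth_manifold A" "h \<in> Cinf A" "x \<in> vector_fields A"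
  shows "smult h x \<in> vector_fields A"
  unfolding vector_fields_iff smult_def
  using vector_fieldsD(1)[OF assms(3)] vector_fieldsD(2)[OF assms(3)] vector_fieldsD(3)[OF assms(3)]
    vector_fieldsD(4)[OF assms(3)] vector_fieldsD(5)[OF assms(3)] Cinf_mult[OF assms(1,2)]
  by (auto simp: distrib_left mult.left_commute)

lemma vf_zero: "smooth_manifold A \<Longrightarrow> 0 \<in> vector_fields A"
  using Cinf_const[of A 0] unfolding vector_fields_iff by (auto simp: fun_eq_iff zero_fun_def)

lemma vf_diff:
  assumes "smooth_manifold A" "x \<in> vector_fields A" "y \<in> vector_fields A"
  shows "x - y \<in> vector_fields A"
proof -
  have eq: "x - y = x + smult (\<lambda>_. -1) y" by (simp add: fun_eq_iff smult_def)
  show ?thesis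
    unfolding eq by (rule vf_add[OF assms(1,2) vf_smult[OF assms(1) Cinf_const[OF assms(1)] assms(3)]])
qed

lemma vf_sum:
  "smooth_manifold A \<Longrightarrow> (\<And>i. i \<in> I \<Longrightarrow> x i \<in> vector_fields A) \<Longrightarrow> (\<Sum>i\<in>I. x i) \<in> vector_fields A"
proof (induction I rule: infinite_finite_induct)
  case (insert j F)
  show ?case unfolding sum.insert[OF insert.hyps] using insert by (intro vf_add) auto
qed (simp_all add: vf_zero)

lemma vf_lie_bracket:
  assumes A: "smooth_manifold A" and x: "x \<in> vector_fields A" and y: "y \<in> vector_fields A"
  shows "lie_bracket x y \<in> vector_fields A"
proof -
  note xD = vector_fieldsD[OF x] and yD = vector_fieldsD[OF y]
  note x0 = vector_field_const[OF A x, of 0] and y0 = vector_field_const[OF A y, of 0]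
  show ?thesis
    unfolding vector_fields_iff
  proof (intro conjI ballI allI impI)
    fix f h assume f: "f \<in> Cinf A" and h: "h \<in> Cinf A"
    note C = Cinf_mult[OF A] xD(1) yD(1) f h
    show "lie_bracket x y (f + h) = lie_bracket x y f + lie_bracket x y h"
      unfolding lie_bracket_def xD(3)[OF f h] yD(3)[OF f h]
      by (simp add: xD(3) yD(3) C algebra_simps)
    show "lie_bracket x y (f * h) = f * lie_bracket x y h + h * lie_bracket x y f"
      unfolding lie_bracket_def xD(5)[OF f h] yD(5)[OF f h]
      by (simp add: xD(3,5) yD(3,5) C algebra_simps)
  next
    fix c f assume f: "f \<in> Cinf A"
    show "lie_bracket x y (\<lambda>q. c * f q) = (\<lambda>q. c * lie_bracket x y f q)"
      unfolding lie_bracket_def xD(4)[OF f] yD(4)[OF f]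
      by (simp add: xD(4) yD(4) xD(1) yD(1) f fun_eq_iff algebra_simps)
  next
    show "lie_bracket x y f \<in> Cinf A" if "f \<in> Cinf A" for f
      unfolding lie_bracket_def using that by (intro Cinf_diff[OF A] xD(1) yD(1))
    show "lie_bracket x y f = 0" if "f \<notin> Cinf A" for f
      unfolding lie_bracket_def using x0 y0 xD(2)[OF that] yD(2)[OF that] by (simp add: zero_fun_def)
  qed
qed

lemma ex_basis_at:
  fixes A :: "('a::{t2_space,second_countable_topology}, 'n::finite) atlas"
  assumes A: "smooth_manifold A"
  shows "\<exists>e. basis_at A p e"
proof -
  obtain E :: "'n \<Rightarrow> 'a vfield" and b c
    where E: "\<And>i. E i \<in> vector_fields A" and b: "b p \<noteq> 0"
    and span: "\<And>q v f. v \<in> tangent_space A q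
        \<Longrightarrow> b q ^ 3 * v f = (\<Sum>i\<in>UNIV. (b q * v (c i) - c i q * v b) * E i f q)"
    and dual: "\<And>i j. b p * E i (c j) p - c j p * E i b p = (if i = j then b p ^ 3 else 0)"
    by (rule local_frame[OF A, of p]) blast
  have "basis_at A p E"
    unfolding basis_at_def
  proof (intro conjI allI impI ballI)
    fix a :: "'n \<Rightarrow> real" and j
    assume *: "\<forall>f. (\<Sum>i\<in>UNIV. a i * E i f p) = 0"
    have "0 = b p * (\<Sum>i\<in>UNIV. a i * E i (c j) p) - c j p * (\<Sum>i\<in>UNIV. a i * E i b p)"
      using * by simp
    also have "\<dots> = (\<Sum>i\<in>UNIV. a i * (b p * E i (c j) p - c j p * E i b p))"
      by (simp add: sum_distrib_left sum_subtractf algebra_simps)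
    also have "\<dots> = (\<Sum>i\<in>UNIV. if i = j then a j * b p ^ 3 else 0)"
      by (rule sum.cong) (simp_all add: dual)
    also have "\<dots> = a j * b p ^ 3" by simp
    finally show "a j = 0" using b by simp
  next
    fix v assume v: "v \<in> tangent_space A p"
    have "v f = (\<Sum>i\<in>UNIV. (b p * v (c i) - c i p * v b) / b p ^ 3 * E i f p)" for f
      using span[OF v, of f] b by (simp add: sum_divide_distrib[symmetric] field_simps)
    then show "\<exists>a. \<forall>f. v f = (\<Sum>i\<in>UNIV. a i * E i f p)"
      by (intro exI[of _ "\<lambda>i. (b p * v (c i) - c i p * v b) / b p ^ 3"] allI)
  qed (rule E)
  then show ?thesis by blast
qed

text \<open>
  \<open>C\<^sup>\<infinity>\<close>-linear functionals, i.e. 1-forms. Tensors of higher rank are treated one argument at a time.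
\<close>

definition tensorial ::
    "('a::{t2_space,second_countable_topology}, 'n::finite) atlas \<Rightarrow> ('a vfield \<Rightarrow> 'a \<Rightarrow> real) \<Rightarrow> bool" where
  "tensorial A \<theta> \<longleftrightarrow>
     (\<forall>x\<in>vector_fields A. \<forall>y\<in>vector_fields A. \<theta> (x + y) = \<theta> x + \<theta> y) \<and>
     (\<forall>f\<in>Cinf A. \<forall>x\<in>vector_fields A. \<theta> (smult f x) = f * \<theta> x)"

lemma tensorialD:
  assumes "tensorial A \<theta>" "x \<in> vector_fields A"
  shows "y \<in> vector_fields A \<Longrightarrow> \<theta> (x + y) = \<theta> x + \<theta> y" and "f \<in> Cinf A \<Longrightarrow> \<theta> (smult f x) = f * \<theta> x"
  using assms by (auto simp: tensorial_def)

lemma tensorial_sum: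
  assumes "smooth_manifold A" "tensorial A \<theta>"
    and "\<And>i. i \<in> I \<Longrightarrow> f i \<in> Cinf A" "\<And>i. i \<in> I \<Longrightarrow> x i \<in> vector_fields A"
  shows "\<theta> (\<Sum>i\<in>I. smult (f i) (x i)) = (\<Sum>i\<in>I. f i * \<theta> (x i))"
  using assms(3,4)
proof (induction I rule: infinite_finite_induct)
  case (insert j F)
  have "\<theta> (smult (f j) (x j) + (\<Sum>i\<in>F. smult (f i) (x i)))
      = \<theta> (smult (f j) (x j)) + \<theta> (\<Sum>i\<in>F. smult (f i) (x i))"
    using insert.prems by (intro tensorialD(1)[OF assms(2)] vf_sum vf_smult assms(1)) auto
  moreover have "\<theta> (smult (f j) (x j)) = f j * \<theta> (x j)"
    using insert.prems by (intro tensorialD(2)[OF assms(2)]) auto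
  moreover have "\<theta> (\<Sum>i\<in>F. smult (f i) (x i)) = (\<Sum>i\<in>F. f i * \<theta> (x i))"
    using insert by blast
  ultimately show ?case
    unfolding sum.insert[OF insert.hyps] by metis
next
  case empty
  have "\<theta> (0 + 0) = \<theta> 0 + \<theta> 0" using tensorialD(1)[OF assms(2)] vf_zero[OF assms(1)] by blast
  then have "\<theta> 0 = 0" by simp
  then show ?case unfolding sum.empty .
next
  case (infinite I)
  have "\<theta> (0 + 0) = \<theta> 0 + \<theta> 0" using tensorialD(1)[OF assms(2)] vf_zero[OF assms(1)] by blast
  then have "\<theta> 0 = 0" by simp
  then show ?case unfolding sum.infinite[OF infinite.hyps] .
qed

text \<open>
  Multiplied by \<open>b\<^sup>3\<close>, the field \<open>x\<close> is a \<open>C\<^sup>\<infinity>\<close>-combination of the frame of \<open>local_frame\<close>, with coefficients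
  that vanish at \<open>p\<close>; a tensor respects such combinations.
\<close>

lemma tensorial_zero_at:
  fixes A :: "('a::{t2_space,second_countable_topology}, 'n::finite) atlas"
  assumes A: "smooth_manifold A" and \<theta>: "tensorial A \<theta>" and x: "x \<in> vector_fields A"
    and zero: "\<And>f. x f p = 0"
  shows "\<theta> x p = 0"
proof -
  obtain E :: "'n \<Rightarrow> 'a vfield" and b c
    where E: "\<And>i. E i \<in> vector_fields A" and C: "b \<in> Cinf A" "\<And>i. c i \<in> Cinf A" and b: "b p \<noteq> 0"
    and span: "\<And>q v f. v \<in> tangent_space A q
        \<Longrightarrow> b q ^ 3 * v f = (\<Sum>i\<in>UNIV. (b q * v (c i) - c i q * v b) * E i f q)"
    by (rule local_frame[OF A, of p]) blast
  let ?w = "\<lambda>i. b * x (c i) - c i * x b"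
  note xD = vector_fieldsD[OF x]
  have w: "?w i \<in> Cinf A" for i by (intro Cinf_diff Cinf_mult A C xD(1))
  have "smult (b * (b * b)) x = (\<Sum>i\<in>UNIV. smult (?w i) (E i))"
    using span[OF xD(6)] by (simp add: fun_eq_iff smult_def sum_fun_apply power3_eq_cube mult.assoc)
  then have "\<theta> (smult (b * (b * b)) x) = \<theta> (\<Sum>i\<in>UNIV. smult (?w i) (E i))" by simp
  then have "b * (b * b) * \<theta> x = (\<Sum>i\<in>UNIV. ?w i * \<theta> (E i))"
    by (simp add: tensorial_sum[OF A \<theta> w E] tensorialD(2)[OF \<theta> x] Cinf_mult[OF A] C)
  then have "(b * (b * b) * \<theta> x) p = (\<Sum>i\<in>UNIV. ?w i * \<theta> (E i)) p" by (rule fun_cong)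
  then show ?thesis using b zero by (simp add: sum_fun_apply)
qed

section \<open>Linear connections and curvature\<close>

text \<open>
  Linearity over the constants is all that a change of basis with constant coefficients uses. The
  curvature has it because vector fields kill constants, so that no product rule interferes.
\<close>

definition real_linear ::
    "('a::{t2_space,second_countable_topology}, 'n::finite) atlas \<Rightarrow> ('a vfield \<Rightarrow> real) \<Rightarrow> bool" where
  "real_linear A \<theta> \<longleftrightarrow>
     (\<forall>x\<in>vector_fields A. \<forall>y\<in>vector_fields A. \<theta> (x + y) = \<theta> x + \<theta> y) \<and>
     (\<forall>c. \<forall>x\<in>vector_fields A. \<theta> (smult (\<lambda>_. c) x) = c * \<theta> x)"

lemma real_linearI:
  assumes "\<And>x y. x \<in> vector_fields A \<Longrightarrow> y \<in> vector_fields A \<Longrightarrow> \<theta> (x + y) = \<theta> x + \<theta> y"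
    and "\<And>c x. x \<in> vector_fields A \<Longrightarrow> \<theta> (smult (\<lambda>_. c) x) = c * \<theta> x"
  shows "real_linear A \<theta>"
  using assms unfolding real_linear_def by blast

lemma real_linear_combination:
  fixes A :: "('a::{t2_space,second_countable_topology}, 'n::finite) atlas"
  assumes A: "smooth_manifold A" and \<theta>: "real_linear A \<theta>" and x: "\<And>i. i \<in> I \<Longrightarrow> x i \<in> vector_fields A"
  shows "\<theta> (\<Sum>i\<in>I. smult (\<lambda>_. c i) (x i)) = (\<Sum>i\<in>I. c i * \<theta> (x i))"
proof -
  have "\<theta> (0 + 0) = \<theta> 0 + \<theta> 0" using \<theta> vf_zero[OF A] unfolding real_linear_def by blast
  then have zero: "\<theta> 0 = 0" by simp
  show ?thesis using x
  proof (induction I rule: infinite_finite_induct)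
    case (insert j F)
    have "\<theta> (smult (\<lambda>_. c j) (x j) + (\<Sum>i\<in>F. smult (\<lambda>_. c i) (x i)))
        = \<theta> (smult (\<lambda>_. c j) (x j)) + \<theta> (\<Sum>i\<in>F. smult (\<lambda>_. c i) (x i))"
    proof -
      have "smult (\<lambda>_. c j) (x j) \<in> vector_fields A"
        using insert.prems by (intro vf_smult A Cinf_const) auto
      moreover have "(\<Sum>i\<in>F. smult (\<lambda>_. c i) (x i)) \<in> vector_fields A"
        using insert.prems by (intro vf_sum vf_smult A Cinf_const) auto
      ultimately show ?thesis using \<theta> unfolding real_linear_def by blast
    qed
    moreover have "\<theta> (smult (\<lambda>_. c j) (x j)) = c j * \<theta> (x j)"
      using insert.prems \<theta> unfolding real_linear_def by blast
    moreover have "\<theta> (\<Sum>i\<in>F. smult (\<lambda>_. c i) (x i)) = (\<Sum>i\<in>F. c i * \<theta> (x i))"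
      using insert by blast
    ultimately show ?case
      by (simp only: sum.insert[OF insert.hyps])
  next
    case empty
    show ?case unfolding sum.empty by (rule zero)
  next
    case (infinite I)
    show ?case unfolding sum.infinite[OF infinite.hyps] by (rule zero)
  qed
qed

lemma smult_simps:
  "smult f (x + y) = smult f x + smult f y" "smult f (x - y) = smult f x - smult f y"
  "smult f (smult h x) = smult (f * h) x" "smult 0 x = 0"
  by (simp_all add: smult_def fun_eq_iff algebra_simps)

lemma linear_connectionD:
  assumes "linear_connection A D" "x \<in> vector_fields A" "y \<in> vector_fields A"
  shows "D x y \<in> vector_fields A"
    and "z \<in> vector_fields A \<Longrightarrow> D (x + y) z = D x z + D y z"
    and "z \<in> vector_fields A \<Longrightarrow> D x (y + z) = D x y + D x z"
    and "f \<in> Cinf A \<Longrightarrow> D (smult f x) y = smult f (D x y)"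
    and "f \<in> Cinf A \<Longrightarrow> D x (smult f y) = smult (x f) y + smult f (D x y)"
  using assms unfolding linear_connection_def by blast+

lemma linear_connection_const:
  assumes "smooth_manifold A" "linear_connection A D" "x \<in> vector_fields A" "y \<in> vector_fields A"
  shows "D (smult (\<lambda>_. c) x) y = smult (\<lambda>_. c) (D x y)" "D x (smult (\<lambda>_. c) y) = smult (\<lambda>_. c) (D x y)"
  using linear_connectionD(4,5)[OF assms(2-4) Cinf_const[OF assms(1)], of c]
    vector_field_const[OF assms(1,3), of c] smult_simps(4)[of y] by simp_all

lemma lie_bracket_add_left:
  assumes A: "smooth_manifold A" and x: "x \<in> vector_fields A" "x' \<in> vector_fields A" and y: "y \<in> vector_fields A"
  shows "lie_bracket (x + x') y = lie_bracket x y + lie_bracket x' y"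
proof
  fix f
  show "lie_bracket (x + x') y f = (lie_bracket x y + lie_bracket x' y) f"
  proof (cases "f \<in> Cinf A")
    case True
    have "y (x f + x' f) = y (x f) + y (x' f)"
      by (rule vector_fieldsD(3)[OF y vector_fieldsD(1)[OF x(1) True] vector_fieldsD(1)[OF x(2) True]])
    then show ?thesis by (simp add: lie_bracket_def)
  next
    case False
    have "y 0 = 0" using vector_field_const[OF A y, of 0] by (simp add: zero_fun_def)
    moreover have "x f = 0" "x' f = 0" using vector_fieldsD(2)[OF x(1)] vector_fieldsD(2)[OF x(2)] False by blast+
    ultimately show ?thesis by (simp add: lie_bracket_def)
  qed
qed

lemma lie_bracket_const_left:
  assumes A: "smooth_manifold A" and x: "x \<in> vector_fields A" and y: "y \<in> vector_fields A"
  shows "lie_bracket (smult (\<lambda>_. c) x) y = smult (\<lambda>_. c) (lie_bracket x y)"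
proof
  fix f
  show "lie_bracket (smult (\<lambda>_. c) x) y f = smult (\<lambda>_. c) (lie_bracket x y) f"
  proof (cases "f \<in> Cinf A")
    case True
    have "y (\<lambda>q. c * x f q) = (\<lambda>q. c * y (x f) q)"
      by (rule vector_fieldsD(4)[OF y vector_fieldsD(1)[OF x True]])
    then show ?thesis by (simp add: lie_bracket_def smult_def times_fun_def fun_eq_iff algebra_simps)
  next
    case False
    have "y 0 = 0" using vector_field_const[OF A y, of 0] by (simp add: zero_fun_def)
    moreover have "x f = 0" by (rule vector_fieldsD(2)[OF x False])
    ultimately show ?thesis by (simp add: lie_bracket_def smult_def)
  qed
qed

context
  fixes A :: "('a::{t2_space,second_countable_topology}, 'n::finite) atlas" and D
  assumes A: "smooth_manifold A" and D: "linear_connection A D"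
begin

lemma curvature_in_vf:
  assumes "x \<in> vector_fields A" "y \<in> vector_fields A" "z \<in> vector_fields A"
  shows "curvature D x y z \<in> vector_fields A"
  unfolding curvature_def using assms
  by (intro vf_diff A linear_connectionD(1)[OF D] vf_lie_bracket)

lemma curvature_add_left:
  assumes v: "x \<in> vector_fields A" "x' \<in> vector_fields A" "y \<in> vector_fields A" "z \<in> vector_fields A"
  shows "curvature D (x + x') y z = curvature D x y z + curvature D x' y z"
  unfolding curvature_def lie_bracket_add_left[OF A v(1-3)] linear_connectionD(2)[OF D v(1,2) v(4)]
  by (simp add: linear_connectionD(2,3)[OF D] linear_connectionD(1)[OF D] vf_lie_bracket[OF A] v)

lemma curvature_const_left:
  assumes v: "x \<in> vector_fields A" "y \<in> vector_fields A" "z \<in> vector_fields A"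
  shows "curvature D (smult (\<lambda>_. c) x) y z = smult (\<lambda>_. c) (curvature D x y z)"
  unfolding curvature_def lie_bracket_const_left[OF A v(1,2)]
  by (simp add: linear_connection_const[OF A D] linear_connectionD(1)[OF D] vf_lie_bracket[OF A] v smult_simps)

lemma curvature_swap:
  assumes v: "x \<in> vector_fields A" "y \<in> vector_fields A" "z \<in> vector_fields A"
  shows "curvature D y x z = smult (\<lambda>_. -1) (curvature D x y z)"
proof -
  have "lie_bracket y x = smult (\<lambda>_. -1) (lie_bracket x y)"
    by (simp add: lie_bracket_def smult_def fun_eq_iff)
  then have "D (lie_bracket y x) z = smult (\<lambda>_. -1) (D (lie_bracket x y) z)"
    by (simp add: linear_connection_const(1)[OF A D] v vf_lie_bracket[OF A])
  then show ?thesis by (simp add: curvature_def smult_def fun_eq_iff)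
qed

lemma curvature_add_mid:
  assumes v: "x \<in> vector_fields A" "y \<in> vector_fields A" "y' \<in> vector_fields A" "z \<in> vector_fields A"
  shows "curvature D x (y + y') z = curvature D x y z + curvature D x y' z"
  unfolding curvature_swap[OF vf_add[OF A v(2,3)] v(1) v(4)] curvature_swap[OF v(2) v(1) v(4)]
    curvature_swap[OF v(3) v(1) v(4)] curvature_add_left[OF v(2,3) v(1) v(4)] smult_simps ..

lemma curvature_const_mid:
  assumes v: "x \<in> vector_fields A" "y \<in> vector_fields A" "z \<in> vector_fields A"
  shows "curvature D x (smult (\<lambda>_. c) y) z = smult (\<lambda>_. c) (curvature D x y z)"
  unfolding curvature_swap[OF vf_smult[OF A Cinf_const[OF A] v(2)] v(1,3)] curvature_swap[OF v(2,1,3)]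
    curvature_const_left[OF v(2,1,3)] by (simp add: smult_simps mult.commute)

lemma curvature_add_right:
  assumes v: "x \<in> vector_fields A" "y \<in> vector_fields A" "z \<in> vector_fields A" "z' \<in> vector_fields A"
  shows "curvature D x y (z + z') = curvature D x y z + curvature D x y z'"
  unfolding curvature_def
  by (simp add: linear_connectionD(3)[OF D] linear_connectionD(1)[OF D] vf_lie_bracket[OF A] v)

lemma curvature_const_right:
  assumes v: "x \<in> vector_fields A" "y \<in> vector_fields A" "z \<in> vector_fields A"
  shows "curvature D x y (smult (\<lambda>_. c) z) = smult (\<lambda>_. c) (curvature D x y z)"
  unfolding curvature_def
  by (simp add: linear_connection_const[OF A D] linear_connectionD(1)[OF D] vf_lie_bracket[OF A] v smult_simps)

end

section \<open>Orthonormal bases and contractions\<close>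

text \<open>
  Gram-Schmidt orthogonalisation for the scalar product with matrix \<open>G\<close>; the rows of \<open>C\<close> are the
  orthonormal vectors.
\<close>

lemma gram_schmidt:
  fixes G :: "real ^ 'n ^ 'n"
  assumes symG: "transpose G = G" and pos: "\<And>x. x \<noteq> 0 \<Longrightarrow> x \<bullet> (G *v x) > 0"
  shows "\<exists>C :: real ^ 'n ^ 'n. C ** G ** transpose C = mat 1"
proof -
  have sym': "x \<bullet> (G *v y) = y \<bullet> (G *v x)" for x y
  proof -
    have "x \<bullet> (G *v y) = (x v* G) \<bullet> y" by (rule dot_lmul_matrix[symmetric])
    also have "x v* G = transpose G *v x" by (rule transpose_matrix_vector[symmetric])
    also have "\<dots> = G *v x" unfolding symG ..
    finally show ?thesis unfolding inner_commute[of y] .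
  qed
  have "\<exists>u. \<forall>i\<in>J. \<forall>j\<in>J. u i \<bullet> (G *v u j) = (if i = j then 1 else 0)" for J :: "'n set"
  proof (induction J rule: finite_induct[OF finite])
    case (2 k J)
    then obtain u where u: "\<And>i j. i \<in> J \<Longrightarrow> j \<in> J \<Longrightarrow> u i \<bullet> (G *v u j) = (if i = j then 1 else 0)"
      by blast
    have "card (insert k J) \<le> CARD('n)" by (intro card_mono) auto
    then have "card J < CARD('n)" using 2(1,2) by simp
    moreover have "dim (u ` J) \<le> card J"
      using dim_le_card[OF span_superset, of "u ` J"] card_image_le[of J u] 2(1) by simp
    ultimately have "span (u ` J) \<noteq> UNIV"
      by (metis DIM_cart DIM_real dim_UNIV dim_span mult.right_neutral not_less)
    \<comment> \<open>Subtract from some \<open>w\<close> outside the span of the vectors found so far its projection to this span,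
      and normalise.\<close>
    then obtain w where w: "w \<notin> span (u ` J)" by blast
    define z where "z = w - (\<Sum>j\<in>J. (w \<bullet> (G *v u j)) *\<^sub>R u j)"
    have "z \<noteq> 0"
    proof
      assume "z = 0"
      then have "w = (\<Sum>j\<in>J. (w \<bullet> (G *v u j)) *\<^sub>R u j)" by (simp add: z_def)
      moreover have "(\<Sum>j\<in>J. (w \<bullet> (G *v u j)) *\<^sub>R u j) \<in> span (u ` J)"
        by (intro span_sum span_scale span_base) auto
      ultimately show False using w by simp
    qed
    then have N: "z \<bullet> (G *v z) > 0" by (rule pos)
    have orth: "z \<bullet> (G *v u i) = 0" if "i \<in> J" for i
    proof -
      have "(\<Sum>j\<in>J. (w \<bullet> (G *v u j)) * (u j \<bullet> (G *v u i))) = (\<Sum>j\<in>J. if j = i then w \<bullet> (G *v u i) else 0)"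
        by (rule sum.cong) (use that u in auto)
      then show ?thesis using that 2(1) by (simp add: z_def inner_diff_left inner_sum_left)
    qed
    define s where "s = 1 / sqrt (z \<bullet> (G *v z))"
    have s: "s * (s * (z \<bullet> (G *v z))) = 1"
      using N real_sqrt_mult_self[of "z \<bullet> (G *v z)"] by (simp add: s_def field_simps)
    let ?u = "u(k := s *\<^sub>R z)"
    have "?u i \<bullet> (G *v ?u j) = (if i = j then 1 else 0)" if ij: "i \<in> insert k J" "j \<in> insert k J" for i j
    proof (cases "i = k")
      case True
      then show ?thesis using ij 2(2) s orth[of j] by (auto simp: matrix_vector_mult_scaleR)
    next
      case i: False
      show ?thesis
      proof (cases "j = k")
        case True
        then show ?thesis
          using i ij orth[of i] sym'[of "u i" z] by (simp add: matrix_vector_mult_scaleR)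
      qed (use i ij u in auto)
    qed
    then show ?case by blast
  qed auto
  from this[of UNIV] obtain u :: "'n \<Rightarrow> real ^ 'n"
    where u: "\<And>i j. u i \<bullet> (G *v u j) = (if i = j then 1 else 0)" by auto
  have "(\<chi> i. u i) ** (G ** transpose (\<chi> i. u i)) = mat 1"
    unfolding vec_eq_iff
  proof (intro allI)
    fix i j
    show "((\<chi> i. u i) ** (G ** transpose (\<chi> i. u i))) $ i $ j = mat 1 $ i $ j"
      using u[of i j] by (simp add: mat_def matrix_matrix_mult_def transpose_def inner_vec_def matrix_vector_mult_def)
  qed
  then have "(\<chi> i. u i) ** G ** transpose (\<chi> i. u i) = mat 1" by (simp only: matrix_mul_assoc)
  then show ?thesis by blast
qed

locale riemannian_manifold =
  fixes A :: "('a::{t2_space,second_countable_topology}, 'n::finite) atlas" and g :: "'a tensor02"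
  assumes A: "smooth_manifold A" and g: "riemannian_metric A g"
begin

abbreviation "X \<equiv> vector_fields A"

lemmas X_closed = vf_add[OF A] vf_diff[OF A] vf_smult[OF A]
lemmas const_Cinf = Cinf_const[OF A]

lemma metric:
  assumes "x \<in> X" "y \<in> X"
  shows "g x y \<in> Cinf A"
    and "z \<in> X \<Longrightarrow> g (x + y) z = g x z + g y z"
    and "f \<in> Cinf A \<Longrightarrow> g (smult f x) y = f * g x y"
    and "g x y = g y x"
    and "x f p \<noteq> 0 \<Longrightarrow> g x x p > 0"
  using g assms unfolding riemannian_metric_def by blast+

lemma metric_add_right:
  assumes v: "x \<in> X" "y \<in> X" "z \<in> X"
  shows "g z (x + y) = g z x + g z y"
  using metric(2)[OF v] by (simp add: metric(4)[OF v(3)] v X_closed)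

lemma metric_smult_right:
  assumes v: "x \<in> X" "y \<in> X" "f \<in> Cinf A"
  shows "g x (smult f y) = f * g x y"
  using metric(3)[OF v(2,1,3)] by (simp add: metric(4)[OF v(1)] v X_closed)

lemma tensorial_metric_left: "z \<in> X \<Longrightarrow> tensorial A (\<lambda>x. g x z)"
  by (simp add: tensorial_def metric(2,3))

lemma tensorial_metric_right: "z \<in> X \<Longrightarrow> tensorial A (g z)"
  by (simp add: tensorial_def metric_add_right metric_smult_right)

lemma metric_diff_left:
  assumes v: "x \<in> X" "y \<in> X" "z \<in> X"
  shows "g (x - y) z = g x z - g y z"
  using metric(2)[OF vf_diff[OF A v(1,2)] v(2,3)] by simp

lemma metric_definite:
  assumes "x \<in> X" "g x x = 0"
  shows "x = 0"
  using metric(5)[OF assms(1,1)] assms(2) by (metis less_irrefl zero_fun_apply ext)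

text \<open>
  The third condition, the expansion of a field at \<open>p\<close>, says that the orthonormal vectors span.
\<close>

definition orthonormal_at :: "'a \<Rightarrow> ('n \<Rightarrow> 'a vfield) \<Rightarrow> bool" where
  "orthonormal_at p u \<longleftrightarrow>
     (\<forall>k. u k \<in> X) \<and> (\<forall>k l. g (u k) (u l) p = (if k = l then 1 else 0)) \<and>
     (\<forall>x\<in>X. \<forall>f. x f p = (\<Sum>k\<in>UNIV. g x (u k) p * u k f p))"

lemma orthonormal_atD:
  assumes "orthonormal_at p u"
  shows "u k \<in> X" "g (u k) (u l) p = (if k = l then 1 else 0)"
    and "x \<in> X \<Longrightarrow> x f p = (\<Sum>k\<in>UNIV. g x (u k) p * u k f p)"
  using assms unfolding orthonormal_at_def by blast+

lemma tensorial_expand: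
  assumes u: "orthonormal_at p u" and \<theta>: "tensorial A \<theta>" and x: "x \<in> X"
  shows "\<theta> x p = (\<Sum>k\<in>UNIV. g x (u k) p * \<theta> (u k) p)"
proof -
  let ?s = "\<Sum>k\<in>UNIV. smult (\<lambda>_. g x (u k) p) (u k)"
  note uX = orthonormal_atD(1)[OF u]
  have s: "?s \<in> X" by (intro vf_sum vf_smult A const_Cinf uX)
  have "?s f p = (\<Sum>k\<in>UNIV. g x (u k) p * u k f p)" for f
    by (simp add: sum_fun_apply smult_def)
  then have "\<theta> (x - ?s) p = 0"
    using orthonormal_atD(3)[OF u x] by (intro tensorial_zero_at[OF A \<theta> vf_diff[OF A x s]]) simp
  moreover have "\<theta> x = \<theta> (x - ?s) + \<theta> ?s" using tensorialD(1)[OF \<theta> vf_diff[OF A x s] s] by simp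
  moreover have "\<theta> ?s p = (\<Sum>k\<in>UNIV. g x (u k) p * \<theta> (u k) p)"
    unfolding tensorial_sum[OF A \<theta> const_Cinf uX] by (simp add: sum_fun_apply)
  ultimately show ?thesis by simp
qed

text \<open>
  The orthonormal basis is a combination of the chosen basis with constant coefficients, so it consists of
  global vector fields, which are orthonormal at \<open>p\<close> only. This suffices, as traces are taken pointwise and
  never differentiated.
\<close>

lemma ex_orthonormal_at:
  obtains C :: "real ^ 'n ^ 'n" and u where
    "\<And>j. basis_of A p j \<in> X"
    "\<And>k. u k = (\<Sum>j\<in>UNIV. smult (\<lambda>_. C $ k $ j) (basis_of A p j))"
    "orthonormal_at p u" "inverse_metric g (basis_of A p) p = transpose C ** C"
proof -
  let ?e = "basis_of A p"
  have be: "basis_at A p ?e" unfolding basis_of_def by (rule someI_ex[OF ex_basis_at[OF A]])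
  have e: "?e j \<in> X" for j using be unfolding basis_at_def by blast
  have indep: "c j = 0" if "\<And>f. (\<Sum>i\<in>UNIV. c i * ?e i f p) = 0" for c j
    using be that unfolding basis_at_def by presburger
  have span: "\<exists>c. \<forall>f. v f = (\<Sum>i\<in>UNIV. c i * ?e i f p)" if "v \<in> tangent_space A p" for v
    using be that unfolding basis_at_def by presburger
  let ?G = "\<chi> i j. g (?e i) (?e j) p"
  let ?s = "\<lambda>a :: real ^ 'n. \<Sum>j\<in>UNIV. smult (\<lambda>_. a $ j) (?e j)"
  have s: "?s a \<in> X" for a by (intro vf_sum vf_smult A const_Cinf e)
  have s_apply: "?s a f p = (\<Sum>j\<in>UNIV. a $ j * ?e j f p)" for a f
    by (simp add: sum_fun_apply smult_def)
  have g_s: "g (?s a) x p = (\<Sum>j\<in>UNIV. a $ j * g (?e j) x p)" if "x \<in> X" for a x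
    unfolding tensorial_sum[OF A tensorial_metric_left[OF that] const_Cinf e] by (simp add: sum_fun_apply)
  have g_ss: "g (?s a) (?s b) p = a \<bullet> (?G *v b)" for a b
  proof -
    have "g (?e j) (?s b) p = (\<Sum>k\<in>UNIV. g (?e j) (?e k) p * b $ k)" for j
      unfolding tensorial_sum[OF A tensorial_metric_right[OF e] const_Cinf e] by (simp add: sum_fun_apply mult.commute)
    then show ?thesis unfolding g_s[OF s] by (simp add: inner_vec_def matrix_vector_mult_def)
  qed
  have symG: "transpose ?G = ?G" unfolding transpose_def vec_eq_iff using metric(4)[OF e e] by simp
  have pos: "a \<bullet> (?G *v a) > 0" if "a \<noteq> 0" for a
  proof -
    have "\<exists>f. ?s a f p \<noteq> 0"
    proof (rule ccontr)
      assume "\<not> ?thesis"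
      then have "(\<Sum>i\<in>UNIV. a $ i * ?e i f p) = 0" for f unfolding s_apply[symmetric] by blast
      then have "a $ j = 0" for j by (rule indep)
      then show False using that by (simp add: vec_eq_iff)
    qed
    then obtain f where "?s a f p \<noteq> 0" by blast
    then show ?thesis unfolding g_ss[symmetric] by (rule metric(5)[OF s s])
  qed
  obtain C :: "real ^ 'n ^ 'n" where C: "C ** ?G ** transpose C = mat 1"
    using gram_schmidt[OF symG pos] by blast
  \<comment> \<open>For square matrices \<open>C G C\<^sup>T = 1\<close> yields \<open>G\<^bsup>-1\<^esup> = C\<^sup>T C\<close>.\<close>
  have "C ** (?G ** transpose C) = mat 1" using C by (simp only: matrix_mul_assoc)
  then have "(?G ** transpose C) ** C = mat 1" using matrix_left_right_inverse by blast
  then have inv: "?G ** (transpose C ** C) = mat 1" by (simp only: matrix_mul_assoc)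
  then have inv': "(transpose C ** C) ** ?G = mat 1" using matrix_left_right_inverse by blast
  define u where "u k = ?s (C $ k)" for k
  have uX: "u k \<in> X" for k unfolding u_def by (rule s)
  have g_uu: "g (u k) (u l) p = (if k = l then 1 else 0)" for k l
  proof -
    have "g (u k) (u l) p = (C ** (?G ** transpose C)) $ k $ l"
      unfolding u_def g_ss by (simp add: matrix_matrix_mult_def transpose_def inner_vec_def matrix_vector_mult_def)
    also have "C ** (?G ** transpose C) = mat 1" using C by (simp only: matrix_mul_assoc)
    finally show ?thesis by (simp add: mat_def)
  qed
  have "x f p = (\<Sum>k\<in>UNIV. g x (u k) p * u k f p)" if x: "x \<in> X" for x f
  proof -
    obtain c where c: "\<And>f. x f p = (\<Sum>i\<in>UNIV. c i * ?e i f p)" using span[OF vector_fieldsD(6)[OF x]] by blast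
    let ?c = "\<chi> i. c i"
    have "(x - ?s ?c) f p = 0" for f using c[of f] s_apply[of ?c f] by simp
    then have zero: "g (x - ?s ?c) (u k) p = 0" for k
      by (rule tensorial_zero_at[OF A tensorial_metric_left[OF uX] vf_diff[OF A x s]])
    have gxu: "g x (u k) p = C $ k \<bullet> (?G *v ?c)" for k
    proof -
      have "g x (u k) p = g (?s ?c) (u k) p" using zero[of k] metric_diff_left[OF x s uX, of ?c k] by simp
      also have "\<dots> = g (u k) (?s ?c) p" unfolding metric(4)[OF s uX] ..
      finally show ?thesis unfolding u_def g_ss .
    qed
    have "(transpose C ** C) *v (?G *v ?c) = ?c"
      by (simp only: matrix_vector_mul_assoc inv' matrix_vector_mul_lid)
    then have cc: "transpose C *v (C *v (?G *v ?c)) = ?c"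
      by (simp only: matrix_vector_mul_assoc matrix_mul_assoc)
    have "(transpose C *v (C *v d)) $ i = (\<Sum>k\<in>UNIV. C $ k $ i * (C $ k \<bullet> d))" for d i
      by (simp add: matrix_vector_mult_def transpose_def inner_vec_def)
    from this[of "?G *v ?c"] have ci: "c i = (\<Sum>k\<in>UNIV. C $ k $ i * g x (u k) p)" for i
      unfolding gxu cc by simp
    have "(\<Sum>k\<in>UNIV. g x (u k) p * u k f p) = (\<Sum>k\<in>UNIV. \<Sum>i\<in>UNIV. C $ k $ i * g x (u k) p * ?e i f p)"
    proof -
      have "u k f p = (\<Sum>i\<in>UNIV. C $ k $ i * ?e i f p)" for k unfolding u_def s_apply ..
      then show ?thesis by (simp add: sum_distrib_left mult_ac)
    qed
    also have "\<dots> = (\<Sum>i\<in>UNIV. c i * ?e i f p)"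
      unfolding ci by (subst sum.swap) (simp add: sum_distrib_right)
    finally show ?thesis unfolding c ..
  qed
  then have "orthonormal_at p u" unfolding orthonormal_at_def using uX g_uu by blast
  moreover have "inverse_metric g ?e p = transpose C ** C"
  proof -
    have "?G ** matrix_inv ?G = mat 1 \<and> matrix_inv ?G ** ?G = mat 1"
      unfolding matrix_inv_def by (rule someI[of _ "transpose C ** C"]) (rule conjI[OF inv inv'])
    then have right: "?G ** matrix_inv ?G = mat 1" by (rule conjunct1)
    have "matrix_inv ?G = ((transpose C ** C) ** ?G) ** matrix_inv ?G"
      by (simp only: inv' matrix_mul_lid)
    also have "\<dots> = (transpose C ** C) ** (?G ** matrix_inv ?G)" by (simp only: matrix_mul_assoc)
    also have "\<dots> = transpose C ** C" by (simp only: right matrix_mul_rid)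
    finally show ?thesis unfolding inverse_metric_def .
  qed
  ultimately show ?thesis using that[of u C] e u_def by blast
qed

text \<open>
  The basis \<open>u\<close> does not depend on the connection, so that two scalar curvatures can be compared term by
  term.
\<close>

lemma scalar_curvature_orthonormal:
  obtains u where "orthonormal_at p u"
    "\<And>D. linear_connection A D \<Longrightarrow> scalar_curvature A g D p
       = (\<Sum>k\<in>UNIV. \<Sum>l\<in>UNIV. g (curvature D (u l) (u k) (u k)) (u l) p)"
proof -
  obtain C :: "real ^ 'n ^ 'n" and u where e: "\<And>j. basis_of A p j \<in> X"
    and u: "\<And>k. u k = (\<Sum>j\<in>UNIV. smult (\<lambda>_. C $ k $ j) (basis_of A p j))"
    and on: "orthonormal_at p u" and inv: "inverse_metric g (basis_of A p) p = transpose C ** C"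
    by (rule ex_orthonormal_at[of p]) blast
  let ?e = "basis_of A p"
  note uX = orthonormal_atD(1)[OF on]
  have contraction: "(\<Sum>i\<in>UNIV. \<Sum>j\<in>UNIV. inverse_metric g ?e p $ i $ j * B (?e i) (?e j))
      = (\<Sum>k\<in>UNIV. B (u k) (u k))"
    if left: "\<And>y. y \<in> X \<Longrightarrow> real_linear A (\<lambda>x. B x y)" and right: "\<And>x. x \<in> X \<Longrightarrow> real_linear A (B x)"
    for B :: "'a vfield \<Rightarrow> 'a vfield \<Rightarrow> real"
  proof -
    have B: "B (u k) (u k) = (\<Sum>i\<in>UNIV. \<Sum>j\<in>UNIV. C $ k $ i * C $ k $ j * B (?e i) (?e j))" for k
    proof -
      have "B (u k) (u k) = (\<Sum>i\<in>UNIV. C $ k $ i * B (?e i) (u k))"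
        using real_linear_combination[where x = ?e and I = UNIV and c = "\<lambda>j. C $ k $ j", OF A left[OF uX[of k]] e]
        unfolding u[symmetric] .
      also have "\<dots> = (\<Sum>i\<in>UNIV. C $ k $ i * (\<Sum>j\<in>UNIV. C $ k $ j * B (?e i) (?e j)))"
        unfolding u real_linear_combination[where x = ?e, OF A right[OF e] e] ..
      finally show ?thesis by (simp add: sum_distrib_left mult.assoc)
    qed
    have "(\<Sum>k\<in>UNIV. B (u k) (u k))
        = (\<Sum>i\<in>UNIV. \<Sum>k\<in>UNIV. \<Sum>j\<in>UNIV. C $ k $ i * C $ k $ j * B (?e i) (?e j))"
      unfolding B by (rule sum.swap)
    also have "\<dots> = (\<Sum>i\<in>UNIV. \<Sum>j\<in>UNIV. \<Sum>k\<in>UNIV. C $ k $ i * C $ k $ j * B (?e i) (?e j))"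
      by (rule sum.cong[OF refl sum.swap])
    also have "\<dots> = (\<Sum>i\<in>UNIV. \<Sum>j\<in>UNIV. (transpose C ** C) $ i $ j * B (?e i) (?e j))"
      by (simp add: matrix_matrix_mult_def transpose_def sum_distrib_right)
    finally show ?thesis unfolding inv ..
  qed
  have "scalar_curvature A g D p = (\<Sum>k\<in>UNIV. \<Sum>l\<in>UNIV. g (curvature D (u l) (u k) (u k)) (u l) p)"
    if D: "linear_connection A D" for D
  proof -
    note cX = curvature_in_vf[OF A D]
    have ricci: "ricci A g D y z p = (\<Sum>l\<in>UNIV. g (curvature D (u l) y z) (u l) p)"
      if "y \<in> X" "z \<in> X" for y z
      unfolding ricci_def Let_def
    proof (rule contraction)
      show "real_linear A (\<lambda>x. g (curvature D x y z) w p)" if "w \<in> X" for w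
        by (rule real_linearI)
          (simp_all add: curvature_add_left[OF A D] curvature_const_left[OF A D] metric(2,3) cX const_Cinf
            \<open>y \<in> X\<close> \<open>z \<in> X\<close> that)
      show "real_linear A (\<lambda>w. g (curvature D x y z) w p)" if "x \<in> X" for x
        by (rule real_linearI)
          (simp_all add: metric_add_right metric_smult_right cX const_Cinf \<open>y \<in> X\<close> \<open>z \<in> X\<close> that)
    qed
    have "scalar_curvature A g D p
        = (\<Sum>i\<in>UNIV. \<Sum>j\<in>UNIV. inverse_metric g ?e p $ i $ j
            * (\<Sum>l\<in>UNIV. g (curvature D (u l) (?e i) (?e j)) (u l) p))"
      unfolding scalar_curvature_def Let_def ricci[OF e e] ..
    also have "\<dots> = (\<Sum>k\<in>UNIV. \<Sum>l\<in>UNIV. g (curvature D (u l) (u k) (u k)) (u l) p)"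
    proof (rule contraction)
      show "real_linear A (\<lambda>y. \<Sum>l\<in>UNIV. g (curvature D (u l) y z) (u l) p)" if "z \<in> X" for z
        by (rule real_linearI)
          (simp_all add: curvature_add_mid[OF A D] curvature_const_mid[OF A D] metric(2,3) cX const_Cinf
            uX that sum.distrib sum_distrib_left)
      show "real_linear A (\<lambda>z. \<Sum>l\<in>UNIV. g (curvature D (u l) y z) (u l) p)" if "y \<in> X" for y
        by (rule real_linearI)
          (simp_all add: curvature_add_right[OF A D] curvature_const_right[OF A D] metric(2,3) cX const_Cinf
            uX that sum.distrib sum_distrib_left)
    qed
    finally show ?thesis .
  qed
  with on show ?thesis by (rule that)
qed

text \<open>
  The matrix of \<open>P\<close> in an orthonormal basis is orthogonal.
\<close>

lemma trace_isometry:
  assumes u: "orthonormal_at p u"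
    and P: "\<And>x. x \<in> X \<Longrightarrow> P x \<in> X" "\<And>x. x \<in> X \<Longrightarrow> P (P x) = x"
      "\<And>x y. x \<in> X \<Longrightarrow> y \<in> X \<Longrightarrow> g (P x) (P y) = g x y"
    and left: "\<And>y. y \<in> X \<Longrightarrow> tensorial A (\<lambda>x. \<Phi> x y)" and right: "\<And>x. x \<in> X \<Longrightarrow> tensorial A (\<Phi> x)"
  shows "(\<Sum>k\<in>UNIV. \<Phi> (P (u k)) (P (u k)) p) = (\<Sum>k\<in>UNIV. \<Phi> (u k) (u k) p)"
proof -
  note uX = orthonormal_atD(1)[OF u]
  have symP: "g (P x) y = g (P y) x" if "x \<in> X" "y \<in> X" for x y
    using P(3)[OF that(1) P(1)[OF that(2)]] P(2)[OF that(2)] metric(4)[OF that(1) P(1)[OF that(2)]] by simp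
  let ?m = "\<lambda>k l. g (P (u k)) (u l) p"
  have orth: "(\<Sum>k\<in>UNIV. ?m k l * ?m k m) = (if l = m then 1 else 0)" for l m
  proof -
    have "(if l = m then 1 else 0) = g (P (u l)) (P (u m)) p"
      by (simp add: P(3) uX orthonormal_atD(2)[OF u])
    also have "\<dots> = (\<Sum>k\<in>UNIV. ?m l k * g (u k) (P (u m)) p)"
      by (rule tensorial_expand[OF u tensorial_metric_left[OF P(1)[OF uX]] P(1)[OF uX]])
    also have "\<dots> = (\<Sum>k\<in>UNIV. ?m k l * ?m k m)"
    proof (rule sum.cong[OF refl])
      fix k
      have "g (P (u l)) (u k) = g (P (u k)) (u l)" by (rule symP[OF uX uX])
      moreover have "g (u k) (P (u m)) = g (P (u k)) (u m)"
        unfolding metric(4)[OF uX P(1)[OF uX]] by (rule symP[OF uX uX])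
      ultimately show "?m l k * g (u k) (P (u m)) p = ?m k l * ?m k m" by (simp only:)
    qed
    finally show ?thesis by simp
  qed
  have "\<Phi> (P (u k)) (P (u k)) p = (\<Sum>l\<in>UNIV. \<Sum>m\<in>UNIV. ?m k l * ?m k m * \<Phi> (u l) (u m) p)" for k
  proof -
    have "\<Phi> (P (u k)) (P (u k)) p = (\<Sum>l\<in>UNIV. ?m k l * \<Phi> (u l) (P (u k)) p)"
      by (rule tensorial_expand[OF u left[OF P(1)[OF uX]] P(1)[OF uX]])
    also have "\<dots> = (\<Sum>l\<in>UNIV. ?m k l * (\<Sum>m\<in>UNIV. ?m k m * \<Phi> (u l) (u m) p))"
      unfolding tensorial_expand[OF u right[OF uX] P(1)[OF uX]] ..
    finally show ?thesis by (simp add: sum_distrib_left mult.assoc)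
  qed
  then have "(\<Sum>k\<in>UNIV. \<Phi> (P (u k)) (P (u k)) p)
      = (\<Sum>k\<in>UNIV. \<Sum>l\<in>UNIV. \<Sum>m\<in>UNIV. ?m k l * ?m k m * \<Phi> (u l) (u m) p)" by simp
  also have "\<dots> = (\<Sum>l\<in>UNIV. \<Sum>k\<in>UNIV. \<Sum>m\<in>UNIV. ?m k l * ?m k m * \<Phi> (u l) (u m) p)"
    by (rule sum.swap)
  also have "\<dots> = (\<Sum>l\<in>UNIV. \<Sum>m\<in>UNIV. \<Sum>k\<in>UNIV. ?m k l * ?m k m * \<Phi> (u l) (u m) p)"
    by (rule sum.cong[OF refl sum.swap])
  also have "\<dots> = (\<Sum>l\<in>UNIV. \<Sum>m\<in>UNIV. (if l = m then \<Phi> (u l) (u m) p else 0))"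
    unfolding sum_distrib_right[symmetric] orth by (intro sum.cong refl) simp
  also have "\<dots> = (\<Sum>k\<in>UNIV. \<Phi> (u k) (u k) p)" by simp
  finally show ?thesis .
qed

lemma trace_zero:
  assumes u: "orthonormal_at p u"
    and P: "\<And>x. x \<in> X \<Longrightarrow> P x \<in> X" "\<And>x. x \<in> X \<Longrightarrow> P (P x) = x"
      "\<And>x y. x \<in> X \<Longrightarrow> y \<in> X \<Longrightarrow> g (P x) (P y) = g x y"
    and tens: "\<And>y. y \<in> X \<Longrightarrow> tensorial A (\<lambda>x. \<Phi> x y)" "\<And>x. x \<in> X \<Longrightarrow> tensorial A (\<Phi> x)"
    and anti: "\<And>x. x \<in> X \<Longrightarrow> \<Phi> (P x) (P x) = - \<Phi> x x"
  shows "(\<Sum>k\<in>UNIV. \<Phi> (u k) (u k) p) = 0"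
proof -
  have "(\<Sum>k\<in>UNIV. \<Phi> (u k) (u k) p) = (\<Sum>k\<in>UNIV. \<Phi> (P (u k)) (P (u k)) p)"
    using trace_isometry[OF u P tens] by simp
  also have "\<dots> = - (\<Sum>k\<in>UNIV. \<Phi> (u k) (u k) p)"
    by (simp add: anti orthonormal_atD(1)[OF u] sum_negf)
  finally show ?thesis by simp
qed

end

section \<open>Algebra of the torsion\<close>

text \<open>
  On the eigenbundles of \<open>P\<close> this can be seen as follows. If \<open>x\<close>, \<open>y\<close>, \<open>z\<close> belong to one
  eigenbundle, \<open>can\<close> together with skewness forces \<open>q x y z = 0\<close>. If \<open>x\<close> and \<open>z\<close> belong to one and \<open>y\<close> to
  the other, \<open>can\<close> becomes \<open>2 q y x z = q x y z - q z y x\<close>, and \<open>cyc\<close> becomes \<open>q x y z = - q z y x\<close>;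
  hence \<open>q y x z = q x y z\<close>. So \<open>T\<close> is zero unless its first two arguments are in one eigenbundle and the
  third is in the other, which is the conclusion.

  Without eigenvectors the conclusion is a linear combination of instances of the hypotheses at
  \<open>x\<close>, \<open>P x\<close>, \<open>y\<close>, \<open>P y\<close>, \<open>z\<close>, \<open>P z\<close>; the proof lists these instances.
\<close>

lemma torsion_P_symmetry:
  fixes q T :: "'v \<Rightarrow> 'v \<Rightarrow> 'v \<Rightarrow> real" and P :: "'v \<Rightarrow> 'v"
  assumes PV: "\<And>x. x \<in> V \<Longrightarrow> P x \<in> V" and PP: "\<And>x. x \<in> V \<Longrightarrow> P (P x) = x"
    and skew: "\<And>x y z. x \<in> V \<Longrightarrow> y \<in> V \<Longrightarrow> z \<in> V \<Longrightarrow> q x y z = - q x z y"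
    and T: "\<And>x y z. T x y z = q x y z - q y x z"
    and cyc: "\<And>x y z. x \<in> V \<Longrightarrow> y \<in> V \<Longrightarrow> z \<in> V \<Longrightarrow>
      (q x y (P z) - q x (P y) z) + (q y z (P x) - q y (P z) x) + (q z x (P y) - q z (P x) y) = 0"
    and can: "\<And>x y z. x \<in> V \<Longrightarrow> y \<in> V \<Longrightarrow> z \<in> V \<Longrightarrow>
      T x y z + T y z x + T (P x) y (P z) + T y (P z) (P x) = 0"
    and V: "x \<in> V" "y \<in> V" "z \<in> V"
  shows "T (P x) y z = T x (P y) z" "T x y (P z) = - T (P x) y z"
proof -
  note V' = V PV[OF V(1)] PV[OF V(2)] PV[OF V(3)]
  have s: "q a b c = - q a c b" if "a \<in> {x, P x}" "b \<in> {y, P y}" "c \<in> {z, P z}" for a b c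
    using that V' by (intro skew) auto
  have s': "q b a c = - q b c a" if "a \<in> {x, P x}" "b \<in> {y, P y}" "c \<in> {z, P z}" for a b c
    using that V' by (intro skew) auto
  have s'': "q c a b = - q c b a" if "a \<in> {x, P x}" "b \<in> {y, P y}" "c \<in> {z, P z}" for a b c
    using that V' by (intro skew) auto
  note PPs = PP[OF V(1)] PP[OF V(2)] PP[OF V(3)]
  \<comment> \<open>The difference of the two sides is one quarter of
    \<open>can(y,x,Pz) - can(Py,Px,Pz) - can(Px,Py,Pz) + can(x,y,Pz) + cyc(x,y,z) - cyc(Px,Py,z)\<close>.\<close>
  show "T (P x) y z = T x (P y) z"
    using can[OF V'(2,1,6)] can[OF V'(5,4,6)] can[OF V'(4,5,6)] can[OF V'(1,2,6)]
      cyc[OF V'(1,2,3)] cyc[OF V'(4,5,3)]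
    by (simp add: T PPs s s' s'')
  \<comment> \<open>Here it is one quarter of \<open>- can(y,Px,z) - can(Py,x,z) + 2 can(Px,y,z) + can(x,Pz,y) + can(x,z,Py)
    - cyc(Px,Py,z) - cyc(x,Py,Pz)\<close>.\<close>
  show "T x y (P z) = - T (P x) y z"
    using can[OF V'(2,4,3)] can[OF V'(5,1,3)] can[OF V'(4,2,3)] can[OF V'(1,6,2)] can[OF V'(1,3,5)]
      cyc[OF V'(4,5,3)] cyc[OF V'(1,5,6)]
    by (simp add: T PPs s s' s'')
qed

lemma sum_rotate:
  fixes f :: "'i::finite \<Rightarrow> 'i \<Rightarrow> 'i \<Rightarrow> real"
  shows "(\<Sum>i\<in>UNIV. \<Sum>k\<in>UNIV. \<Sum>l\<in>UNIV. f k l i) = (\<Sum>i\<in>UNIV. \<Sum>k\<in>UNIV. \<Sum>l\<in>UNIV. f i k l)"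
proof -
  have "(\<Sum>i\<in>UNIV. \<Sum>k\<in>UNIV. \<Sum>l\<in>UNIV. f k l i) = (\<Sum>k\<in>UNIV. \<Sum>i\<in>UNIV. \<Sum>l\<in>UNIV. f k l i)"
    by (rule sum.swap)
  also have "\<dots> = (\<Sum>k\<in>UNIV. \<Sum>l\<in>UNIV. \<Sum>i\<in>UNIV. f k l i)"
    by (rule sum.cong[OF refl sum.swap])
  finally show ?thesis .
qed

text \<open>
  Written in \<open>t\<close>, the summand on the left is a quadratic form in \<open>t i k l\<close> and its two cyclic shifts. All
  three squares have the same sum, and all three mixed products have the sum 0.
\<close>

lemma contorsion_quadratic_sum:
  fixes q t :: "'i::finite \<Rightarrow> 'i \<Rightarrow> 'i \<Rightarrow> real"
  assumes skew: "\<And>i k l. t k i l = - t i k l"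
    and q: "\<And>i k l. 2 * q i k l = t i k l - t k l i + t l i k"
    and cyc: "(\<Sum>i\<in>UNIV. \<Sum>k\<in>UNIV. \<Sum>l\<in>UNIV. t i k l * t k l i) = 0"
  shows "(\<Sum>i\<in>UNIV. \<Sum>k\<in>UNIV. \<Sum>l\<in>UNIV. t i k l * q l k i - q k i l * q i k l)
    = (\<Sum>i\<in>UNIV. \<Sum>k\<in>UNIV. \<Sum>l\<in>UNIV. (t i k l)\<^sup>2) / 4"
proof -
  let ?S = "\<lambda>f :: 'i \<Rightarrow> 'i \<Rightarrow> 'i \<Rightarrow> real. \<Sum>i\<in>UNIV. \<Sum>k\<in>UNIV. \<Sum>l\<in>UNIV. f i k l"
  have pointwise: "t i k l * q l k i - q k i l * q i k l
      = 3 / 4 * (t i k l)\<^sup>2 - 1 / 4 * (t k l i)\<^sup>2 - 1 / 4 * (t l i k)\<^sup>2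
        - 1 / 2 * (t i k l * t k l i) + 1 / 2 * (t k l i * t l i k) - 1 / 2 * (t l i k * t i k l)" for i k l
  proof -
    have e: "q l k i = (t i k l - t k l i - t l i k) / 2" "q k i l = (t l i k - t k l i - t i k l) / 2"
      "q i k l = (t i k l - t k l i + t l i k) / 2"
      using q[of l k i] q[of k i l] q[of i k l] skew[of k i l] skew[of l k i] skew[of i l k] by simp_all
    show ?thesis unfolding e by (simp add: field_simps power2_eq_square)
  qed
  have "?S (\<lambda>i k l. (t k l i)\<^sup>2) = ?S (\<lambda>i k l. (t i k l)\<^sup>2)" by (rule sum_rotate)
  moreover have "?S (\<lambda>i k l. (t l i k)\<^sup>2) = ?S (\<lambda>i k l. (t i k l)\<^sup>2)" by (rule sum_rotate[symmetric])
  moreover have "?S (\<lambda>i k l. t k l i * t l i k) = 0"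
    using sum_rotate[of "\<lambda>i k l. t i k l * t k l i"] cyc by simp
  moreover have "?S (\<lambda>i k l. t l i k * t i k l) = 0"
    using sum_rotate[of "\<lambda>i k l. t l i k * t i k l"] cyc by simp
  ultimately show ?thesis
    unfolding pointwise sum.distrib sum_subtractf sum_distrib_left[symmetric] using cyc by simp
qed

section \<open>The canonical connection of a \<open>W\<^sub>3\<close>-manifold\<close>

locale w3_canonical = riemannian_manifold A g
  for A :: "('a::{t2_space,second_countable_topology}, 'n::finite) atlas" and g :: "'a tensor02" +
  fixes P :: "'a tensor11" and D D' :: "'a connection"
  assumes W3: "W3_manifold A P g D" and LC: "levi_civita A g D" and CC: "canonical_connection A P g D'"
begin

lemma P:
  assumes "x \<in> X"
  shows "P x \<in> X" and "P (P x) = x" and "y \<in> X \<Longrightarrow> P (x + y) = P x + P y"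
    and "f \<in> Cinf A \<Longrightarrow> P (smult f x) = smult f (P x)"
    and "y \<in> X \<Longrightarrow> g (P x) (P y) = g x y"
  using W3 assms unfolding W3_manifold_def riemannian_almost_product_def tensor_field_11_def by simp_all

lemma P_diff: "x \<in> X \<Longrightarrow> y \<in> X \<Longrightarrow> P (x - y) = P x - P y"
  using P(3)[OF vf_diff[OF A], of x y y] by (simp add: algebra_simps)

lemma P_swap: "x \<in> X \<Longrightarrow> y \<in> X \<Longrightarrow> g (P x) y = g x (P y)"
  using P(5)[of x "P y"] P(1,2)[of y] by simp

lemma D: "linear_connection A D" and D': "linear_connection A D'"
  using LC CC unfolding levi_civita_def canonical_connection_def natural_connection_def by blast+

lemmas D_X = linear_connectionD(1)[OF D]
lemmas D'_X = linear_connectionD(1)[OF D']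

lemma D'_P: "x \<in> X \<Longrightarrow> y \<in> X \<Longrightarrow> D' x (P y) = P (D' x y)"
proof -
  assume "x \<in> X" "y \<in> X"
  then have "deriv_P D' P x y = 0" using CC unfolding canonical_connection_def natural_connection_def by blast
  then show ?thesis by (simp add: deriv_P_def)
qed

lemma D'_metric:
  assumes "x \<in> X" "y \<in> X" "z \<in> X"
  shows "x (g y z) = g (D' x y) z + g y (D' x z)"
proof -
  have "deriv_g D' g x y z = 0" using CC assms unfolding canonical_connection_def natural_connection_def by blast
  then show ?thesis by (simp add: deriv_g_def algebra_simps)
qed

lemma D_metric:
  assumes "x \<in> X" "y \<in> X" "z \<in> X"
  shows "x (g y z) = g (D x y) z + g y (D x z)"
proof -
  have "deriv_g D g x y z = 0" using LC assms unfolding levi_civita_def by blast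
  then show ?thesis by (simp add: deriv_g_def algebra_simps)
qed

definition Q :: "'a vfield \<Rightarrow> 'a vfield \<Rightarrow> 'a vfield" where
  "Q x y = D' x y - D x y"

abbreviation q :: "'a vfield \<Rightarrow> 'a vfield \<Rightarrow> 'a vfield \<Rightarrow> 'a \<Rightarrow> real" where
  "q x y z \<equiv> g (Q x y) z"

abbreviation T :: "'a vfield \<Rightarrow> 'a vfield \<Rightarrow> 'a vfield \<Rightarrow> 'a \<Rightarrow> real" where
  "T x y z \<equiv> g (torsion D' x y) z"

lemma Q_X: "x \<in> X \<Longrightarrow> y \<in> X \<Longrightarrow> Q x y \<in> X"
  unfolding Q_def by (intro X_closed D_X D'_X)

lemma Q_tensor:
  assumes v: "x \<in> X" "y \<in> X"
  shows "z \<in> X \<Longrightarrow> Q (x + y) z = Q x z + Q y z"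
    and "z \<in> X \<Longrightarrow> Q x (y + z) = Q x y + Q x z"
    and "f \<in> Cinf A \<Longrightarrow> Q (smult f x) y = smult f (Q x y)"
    and "f \<in> Cinf A \<Longrightarrow> Q x (smult f y) = smult f (Q x y)"
  unfolding Q_def by (simp_all add: linear_connectionD(2-5)[OF D v] linear_connectionD(2-5)[OF D' v] smult_simps)

lemma tensorial_q1: "y \<in> X \<Longrightarrow> z \<in> X \<Longrightarrow> tensorial A (\<lambda>x. q x y z)"
  by (simp add: tensorial_def Q_tensor Q_X metric)

lemma tensorial_q2: "x \<in> X \<Longrightarrow> z \<in> X \<Longrightarrow> tensorial A (\<lambda>y. q x y z)"
  by (simp add: tensorial_def Q_tensor Q_X metric)

lemma torsion_eq_Q:
  assumes v: "x \<in> X" "y \<in> X"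
  shows "torsion D' x y = Q x y - Q y x"
proof -
  have "torsion D x y = 0" using LC v unfolding levi_civita_def by blast
  then have "lie_bracket x y = D x y - D y x" by (simp add: torsion_def)
  then show ?thesis unfolding torsion_def Q_def by simp
qed

lemma torsion_X: "x \<in> X \<Longrightarrow> y \<in> X \<Longrightarrow> torsion D' x y \<in> X"
  by (simp add: torsion_eq_Q Q_X X_closed)

lemma T_eq: "x \<in> X \<Longrightarrow> y \<in> X \<Longrightarrow> z \<in> X \<Longrightarrow> T x y z = q x y z - q y x z"
  by (simp add: torsion_eq_Q metric_diff_left Q_X)

lemma q_skew:
  assumes v: "x \<in> X" "y \<in> X" "z \<in> X"
  shows "q x y z = - q x z y"
proof -
  have "g (D' x y) z + g y (D' x z) = g (D x y) z + g y (D x z)"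
    using D'_metric[OF v] D_metric[OF v] by simp
  moreover have "g y (D' x z) = g (D' x z) y" "g y (D x z) = g (D x z) y"
    by (rule metric(4)[OF v(2) D'_X[OF v(1,3)]], rule metric(4)[OF v(2) D_X[OF v(1,3)]])
  ultimately show ?thesis
    unfolding Q_def by (simp add: metric_diff_left D_X D'_X v) (simp add: algebra_simps)
qed

lemma F_eq_q:
  assumes v: "x \<in> X" "y \<in> X" "z \<in> X"
  shows "g (deriv_P D P x y) z = q x y (P z) - q x (P y) z"
proof -
  have "deriv_P D P x y = P (Q x y) - Q x (P y)"
    unfolding deriv_P_def Q_def by (simp add: P_diff D_X D'_X v D'_P)
  then show ?thesis by (simp add: metric_diff_left P Q_X v P_swap)
qed

lemma torsion_P:
  assumes v: "x \<in> X" "y \<in> X" "z \<in> X"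
  shows "T (P x) y z = T x (P y) z" "T x y (P z) = - T (P x) y z"
proof -
  have cyc: "(q x y (P z) - q x (P y) z) + (q y z (P x) - q y (P z) x) + (q z x (P y) - q z (P x) y) = 0"
    if "x \<in> X" "y \<in> X" "z \<in> X" for x y z
  proof -
    have "g (deriv_P D P x y) z + g (deriv_P D P y z) x + g (deriv_P D P z x) y = 0"
      using W3 that unfolding W3_manifold_def F_tensor_def by blast
    then show ?thesis unfolding F_eq_q[OF that] F_eq_q[OF that(2,3,1)] F_eq_q[OF that(3,1,2)] .
  qed
  have can: "T x y z + T y z x + T (P x) y (P z) + T y (P z) (P x) = 0"
    if "x \<in> X" "y \<in> X" "z \<in> X" for x y z
    using CC that unfolding canonical_connection_def by blast
  let ?t = "\<lambda>p x y z. q x y z p - q y x z p"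
  have t: "T x y z p = ?t p x y z" if "x \<in> X" "y \<in> X" "z \<in> X" for x y z p
    using T_eq[OF that] by simp
  have skew: "q x y z p = - q x z y p" if "x \<in> X" "y \<in> X" "z \<in> X" for x y z p
    using q_skew[OF that] by simp
  have cyc': "(q x y (P z) p - q x (P y) z p) + (q y z (P x) p - q y (P z) x p) + (q z x (P y) p - q z (P x) y p) = 0"
    if "x \<in> X" "y \<in> X" "z \<in> X" for x y z p
    using fun_cong[OF cyc[OF that], of p] by simp
  have can': "?t p x y z + ?t p y z x + ?t p (P x) y (P z) + ?t p y (P z) (P x) = 0"
    if "x \<in> X" "y \<in> X" "z \<in> X" for x y z p
    using fun_cong[OF can[OF that], of p] by (simp add: t P(1) that)
  note sym = torsion_P_symmetry[where V = X and P = P and q = "\<lambda>x y z. q x y z p" and T = "?t p" for p,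
      OF P(1) P(2) skew refl cyc' can' v]
  show "T (P x) y z = T x (P y) z" "T x y (P z) = - T (P x) y z"
    using sym by (simp_all add: fun_eq_iff t P(1) v)
qed

lemma T_skew: "x \<in> X \<Longrightarrow> y \<in> X \<Longrightarrow> z \<in> X \<Longrightarrow> T y x z = - T x y z"
  by (simp add: T_eq)

text \<open>
  This holds for any metric connection: in the alternating sum the terms of \<open>q\<close> cancel by skewness.
\<close>

lemma contorsion:
  assumes v: "x \<in> X" "y \<in> X" "z \<in> X"
  shows "2 * q x y z p = T x y z p - T y z x p + T z x y p"
  using q_skew[OF v] q_skew[OF v(2,3,1)] q_skew[OF v(3,1,2)] by (simp add: T_eq v)

text \<open>
  By \<open>contorsion\<close>, \<open>q x x z = T z x x\<close>, and \<open>T z (P x) (P x) = - T (P z) (P x) x = - T z x x\<close>.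
\<close>

lemma q_P_antiinvariant:
  assumes v: "x \<in> X" "z \<in> X"
  shows "q (P x) (P x) z = - q x x z"
proof
  fix p
  have "T z (P x) (P x) p = - T z x x p"
    using torsion_P[OF v(2) P(1)[OF v(1)] v(1)] torsion_P(1)[OF v(2) P(1)[OF v(1)] v(1)] P(2)[OF v(1)] by simp
  moreover have "T x z x p = - T z x x p" "T (P x) z (P x) p = - T z (P x) (P x) p"
    using T_skew[OF v(2,1,1)] T_skew[OF v(2) P(1)[OF v(1)] P(1)[OF v(1)]] by simp_all
  moreover have "T x x z p = 0" "T (P x) (P x) z p = 0" by (simp_all add: T_eq v P)
  ultimately show "q (P x) (P x) z p = (- q x x z) p"
    using contorsion[OF v(1,1,2), of p] contorsion[OF P(1)[OF v(1)] P(1)[OF v(1)] v(2), of p] by simp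
qed

text \<open>
  The covariant derivative of \<open>q\<close> along \<open>D'\<close> in direction \<open>x\<close>. It is taken along \<open>D'\<close> and not along
  \<open>D\<close> since \<open>P\<close> is parallel for \<open>D'\<close>, so that identities between \<open>q\<close> and \<open>P\<close> are inherited.
\<close>

definition nabla_q :: "'a vfield \<Rightarrow> 'a vfield \<Rightarrow> 'a vfield \<Rightarrow> 'a vfield \<Rightarrow> 'a \<Rightarrow> real" where
  "nabla_q x y z w = x (q y z w) - q (D' x y) z w - q y (D' x z) w - q y z (D' x w)"

lemma q_Cinf: "x \<in> X \<Longrightarrow> y \<in> X \<Longrightarrow> z \<in> X \<Longrightarrow> q x y z \<in> Cinf A"
  by (intro metric(1) Q_X)

lemma tensorial_nabla_q2:
  assumes v: "x \<in> X" "z \<in> X" "w \<in> X"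
  shows "tensorial A (\<lambda>y. nabla_q x y z w)"
  unfolding tensorial_def
proof (intro conjI ballI)
  fix y y' assume y: "y \<in> X" "y' \<in> X"
  show "nabla_q x (y + y') z w = nabla_q x y z w + nabla_q x y' z w"
    unfolding nabla_q_def
    by (simp add: Q_tensor linear_connectionD(3)[OF D'] D'_X Q_X metric(2) vector_fieldsD(3)[OF v(1)] q_Cinf v y)
next
  fix f y assume y: "f \<in> Cinf A" "y \<in> X"
  show "nabla_q x (smult f y) z w = f * nabla_q x y z w"
    unfolding nabla_q_def
    by (simp add: Q_tensor linear_connectionD(5)[OF D'] D'_X Q_X metric(2,3) vector_fieldsD(1,5)[OF v(1)]
        q_Cinf X_closed v y) (simp add: algebra_simps)
qed

lemma tensorial_nabla_q3:
  assumes v: "x \<in> X" "y \<in> X" "w \<in> X"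
  shows "tensorial A (\<lambda>z. nabla_q x y z w)"
  unfolding tensorial_def
proof (intro conjI ballI)
  fix z z' assume z: "z \<in> X" "z' \<in> X"
  show "nabla_q x y (z + z') w = nabla_q x y z w + nabla_q x y z' w"
    unfolding nabla_q_def
    by (simp add: Q_tensor linear_connectionD(3)[OF D'] D'_X Q_X metric(2) vector_fieldsD(3)[OF v(1)] q_Cinf v z)
next
  fix f z assume z: "f \<in> Cinf A" "z \<in> X"
  show "nabla_q x y (smult f z) w = f * nabla_q x y z w"
    unfolding nabla_q_def
    by (simp add: Q_tensor linear_connectionD(5)[OF D'] D'_X Q_X metric(2,3) vector_fieldsD(1,5)[OF v(1)]
        q_Cinf X_closed v z) (simp add: algebra_simps)
qed

lemma nabla_q_skew:
  assumes v: "x \<in> X" "y \<in> X" "z \<in> X" "w \<in> X"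
  shows "nabla_q x y z w = - nabla_q x y w z"
proof -
  have "q y z w + q y w z = 0" using q_skew[OF v(2-4)] by simp
  then have "x (q y z w + q y w z) = 0"
    using vector_field_const[OF A v(1), of 0] by (simp add: zero_fun_def)
  then have "x (q y z w) = - x (q y w z)"
    unfolding vector_fieldsD(3)[OF v(1) q_Cinf[OF v(2-4)] q_Cinf[OF v(2,4,3)]] by (rule eq_neg_iff_add_eq_0[THEN iffD2])
  then show ?thesis
    unfolding nabla_q_def
    using q_skew[OF D'_X[OF v(1,2)] v(3,4)] q_skew[OF v(2) D'_X[OF v(1,3)] v(4)] q_skew[OF v(2,3) D'_X[OF v(1,4)]]
    by simp
qed

lemma nabla_q_P_antiinvariant:
  assumes v: "x \<in> X" "y \<in> X" "w \<in> X"
  shows "nabla_q x (P y) (P y) w = - nabla_q x y y w"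
proof -
  \<comment> \<open>The polarised form is needed, as the product rule separates the two equal arguments.\<close>
  have pol: "q (P a) (P b) w + q (P b) (P a) w = - (q a b w + q b a w)" if ab: "a \<in> X" "b \<in> X" for a b
    using q_P_antiinvariant[OF vf_add[OF A ab] v(3)] q_P_antiinvariant[OF ab(1) v(3)] q_P_antiinvariant[OF ab(2) v(3)]
    by (simp add: P Q_tensor Q_X metric(2) X_closed ab v) (simp add: algebra_simps)
  have "q (P y) (P y) w + q y y w = 0" using q_P_antiinvariant[OF v(2,3)] by simp
  then have "x (q (P y) (P y) w + q y y w) = 0"
    using vector_field_const[OF A v(1), of 0] by (simp add: zero_fun_def)
  then have "x (q (P y) (P y) w) = - x (q y y w)"
    unfolding vector_fieldsD(3)[OF v(1) q_Cinf[OF P(1)[OF v(2)] P(1)[OF v(2)] v(3)] q_Cinf[OF v(2,2,3)]]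
    by (rule eq_neg_iff_add_eq_0[THEN iffD2])
  then show ?thesis
    unfolding nabla_q_def D'_P[OF v(1,2)]
    using pol[OF D'_X[OF v(1,2)] v(2)] q_P_antiinvariant[OF v(2) D'_X[OF v(1,3)]] by (simp add: algebra_simps)
qed

text \<open>
  Substitute \<open>D = D' - Q\<close> in the curvature of \<open>D\<close>. Since \<open>[x, y] = D'\<^sub>x y - D'\<^sub>y x - T(x, y)\<close>, the
  terms of first order in \<open>Q\<close> combine to covariant derivatives along \<open>D'\<close> and one torsion term.
\<close>

lemma curvature_difference:
  assumes v: "x \<in> X" "y \<in> X" "z \<in> X" "w \<in> X"
  shows "g (curvature D' x y z) w - g (curvature D x y z) w
    = nabla_q x y z w - nabla_q y x z w + q (torsion D' x y) z w - q x (Q y z) w + q y (Q x z) w"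
proof -
  have DQ: "D a b = D' a b - Q a b" for a b by (simp add: Q_def)
  have diff: "D' a (b - c) = D' a b - D' a c" if "a \<in> X" "b \<in> X" "c \<in> X" for a b c
    using linear_connectionD(3)[OF D' that(1) vf_diff[OF A that(2,3)] that(3)] by (simp add: algebra_simps)
  have twice: "D a (D b c) = D' a (D' b c) - D' a (Q b c) - Q a (D' b c) + Q a (Q b c)"
    if "a \<in> X" "b \<in> X" "c \<in> X" for a b c
  proof -
    have "D' b c = D b c + Q b c" by (simp add: Q_def)
    then have 1: "Q a (D' b c) = Q a (D b c) + Q a (Q b c)"
      using Q_tensor(2)[OF that(1) D_X[OF that(2,3)] Q_X[OF that(2,3)]] by metis
    have 2: "D' a (D b c) = D' a (D' b c) - D' a (Q b c)"
      unfolding DQ[of b c] by (rule diff[OF that(1) D'_X[OF that(2,3)] Q_X[OF that(2,3)]])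
    show ?thesis unfolding DQ[of a "D b c"] 1 2 by (rule ext)+ simp
  qed
  have lX: "lie_bracket x y \<in> X" by (rule vf_lie_bracket[OF A v(1,2)])
  have N': "g (D' a (Q b c)) w = nabla_q a b c w + q (D' a b) c w + q b (D' a c) w" if "a \<in> X" "b \<in> X" "c \<in> X" for a b c
    unfolding nabla_q_def using D'_metric[OF that(1) Q_X[OF that(2,3)] v(4)] by simp
  have lie: "q (lie_bracket x y) z w = q (D' x y) z w - q (D' y x) z w - q (torsion D' x y) z w"
  proof -
    have "D' x y = lie_bracket x y + D' y x + torsion D' x y" by (simp add: torsion_def)
    then have "q (D' x y) z w = q (lie_bracket x y + D' y x + torsion D' x y) z w" by simp
    also have "\<dots> = q (lie_bracket x y) z w + q (D' y x) z w + q (torsion D' x y) z w"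
      using v by (simp add: Q_tensor(1) metric(2) lX D'_X torsion_X Q_X X_closed)
    finally show ?thesis by simp
  qed
  have eq: "curvature D' x y z - curvature D x y z = D' x (Q y z) + Q x (D' y z) - Q x (Q y z)
      - (D' y (Q x z) + Q y (D' x z) - Q y (Q x z)) - Q (lie_bracket x y) z"
    unfolding curvature_def twice[OF v(1-3)] twice[OF v(2,1,3)] DQ[of "lie_bracket x y"] by simp
  have "g (curvature D' x y z) w - g (curvature D x y z) w = g (curvature D' x y z - curvature D x y z) w"
    by (rule metric_diff_left[symmetric]) (use v in \<open>auto intro!: curvature_in_vf[OF A] D D'\<close>)
  also have "\<dots> = g (D' x (Q y z)) w + q x (D' y z) w - q x (Q y z) w
      - (g (D' y (Q x z)) w + q y (D' x z) w - q y (Q x z) w) - q (lie_bracket x y) z w"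
    unfolding eq by (simp add: metric_diff_left metric(2) Q_X D'_X X_closed v lX)
  finally show ?thesis
    unfolding N'[OF v(1-3)] N'[OF v(2,1,3)] lie by simp
qed

end

section \<open>The difference of the scalar curvatures\<close>

lemma tensorial_mult:
  "tensorial A \<theta> \<Longrightarrow> tensorial A (\<lambda>x. \<theta> x * h)" "tensorial A \<theta> \<Longrightarrow> tensorial A (\<lambda>x. h * \<theta> x)"
  by (simp_all add: tensorial_def algebra_simps)

context w3_canonical
begin

lemma tensorial_T1: "y \<in> X \<Longrightarrow> z \<in> X \<Longrightarrow> tensorial A (\<lambda>x. T x y z)"
  by (simp add: tensorial_def T_eq X_closed Q_tensor Q_X metric(2,3) algebra_simps)

lemma tensorial_T2: "x \<in> X \<Longrightarrow> z \<in> X \<Longrightarrow> tensorial A (\<lambda>y. T x y z)"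
  by (simp add: tensorial_def T_eq X_closed Q_tensor Q_X metric(2,3) algebra_simps)

lemma tensorial_T3: "x \<in> X \<Longrightarrow> y \<in> X \<Longrightarrow> tensorial A (\<lambda>z. T x y z)"
  by (rule tensorial_metric_right[OF torsion_X])

text \<open>
  Replacing \<open>u l\<close> by \<open>P (u l)\<close> does not change the sum, and \<open>torsion_P\<close> moves \<open>P\<close> from \<open>u l\<close> to \<open>u k\<close> in
  both factors with a total sign \<open>-1\<close>. Then \<open>P (u k)\<close> can be replaced by \<open>u k\<close>, so the sum is its own
  negative.
\<close>

lemma torsion_cyclic_trace:
  assumes u: "orthonormal_at p u"
  shows "(\<Sum>i\<in>UNIV. \<Sum>k\<in>UNIV. \<Sum>l\<in>UNIV. T (u i) (u k) (u l) p * T (u k) (u l) (u i) p) = 0"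
proof -
  note uX = orthonormal_atD(1)[OF u]
  note iso = trace_isometry[OF u P(1) P(2) P(5)]
  have "(\<Sum>k\<in>UNIV. \<Sum>l\<in>UNIV. T (u i) (u k) (u l) p * T (u k) (u l) (u i) p) = 0" (is "?S = 0") for i
  proof -
    have flip: "T (u i) (u k) (P (u l)) p * T (u k) (P (u l)) (u i) p
        = - (T (u i) (P (u k)) (u l) p * T (P (u k)) (u l) (u i) p)" for k l
      using torsion_P[OF uX uX uX, of i k l] torsion_P(1)[OF uX uX uX, of k l i] by simp
    have "(\<Sum>l\<in>UNIV. T (u i) (u k) (P (u l)) p * T (u k) (P (u l)) (u i) p)
        = (\<Sum>l\<in>UNIV. T (u i) (u k) (u l) p * T (u k) (u l) (u i) p)" for k
      using iso[of "\<lambda>y z. T (u i) (u k) y * T (u k) z (u i)"]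
      by (simp add: tensorial_mult tensorial_T2 tensorial_T3 uX)
    then have "?S = (\<Sum>k\<in>UNIV. \<Sum>l\<in>UNIV. T (u i) (u k) (P (u l)) p * T (u k) (P (u l)) (u i) p)"
      by simp
    also have "\<dots> = - (\<Sum>k\<in>UNIV. \<Sum>l\<in>UNIV. T (u i) (P (u k)) (u l) p * T (P (u k)) (u l) (u i) p)"
      unfolding flip by (simp add: sum_negf)
    also have "(\<Sum>k\<in>UNIV. \<Sum>l\<in>UNIV. T (u i) (P (u k)) (u l) p * T (P (u k)) (u l) (u i) p)
        = (\<Sum>l\<in>UNIV. \<Sum>k\<in>UNIV. T (u i) (P (u k)) (u l) p * T (P (u k)) (u l) (u i) p)"
      by (rule sum.swap)
    also have "\<dots> = (\<Sum>l\<in>UNIV. \<Sum>k\<in>UNIV. T (u i) (u k) (u l) p * T (u k) (u l) (u i) p)"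
    proof (rule sum.cong[OF refl])
      fix l
      show "(\<Sum>k\<in>UNIV. T (u i) (P (u k)) (u l) p * T (P (u k)) (u l) (u i) p)
          = (\<Sum>k\<in>UNIV. T (u i) (u k) (u l) p * T (u k) (u l) (u i) p)"
        using iso[of "\<lambda>y z. T (u i) y (u l) * T z (u l) (u i)"]
        by (simp add: tensorial_mult tensorial_T1 tensorial_T2 uX)
    qed
    also have "\<dots> = ?S" by (rule sum.swap)
    finally show "?S = 0" by simp
  qed
  then show ?thesis by simp
qed

text \<open>
  In the trace of \<open>curvature_difference\<close> the derivative terms and the term with \<open>Q (u k) (u k)\<close> vanish by
  \<open>trace_zero\<close>. The other two are expanded in the orthonormal basis and fall under
  \<open>contorsion_quadratic_sum\<close>.
\<close>

lemma scalar_curvature_difference: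
  obtains u where "orthonormal_at p u"
    "scalar_curvature A g D' p - scalar_curvature A g D p
      = (\<Sum>i\<in>UNIV. \<Sum>k\<in>UNIV. \<Sum>l\<in>UNIV. (T (u i) (u k) (u l) p)\<^sup>2) / 4"
proof -
  obtain u where u: "orthonormal_at p u"
    and scal: "\<And>D. linear_connection A D \<Longrightarrow> scalar_curvature A g D p
       = (\<Sum>k\<in>UNIV. \<Sum>l\<in>UNIV. g (curvature D (u l) (u k) (u k)) (u l) p)"
    by (rule scalar_curvature_orthonormal[of p]) blast
  note uX = orthonormal_atD(1)[OF u]
  note zero = trace_zero[OF u P(1) P(2) P(5)]
  let ?t = "\<lambda>i k l. T (u i) (u k) (u l) p" and ?q = "\<lambda>i k l. q (u i) (u k) (u l) p"
  have N1: "(\<Sum>k\<in>UNIV. nabla_q (u i) (u k) (u k) (u i) p) = 0" for i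
    by (rule zero[of "\<lambda>y z. nabla_q (u i) y z (u i)"])
      (simp_all add: tensorial_nabla_q2 tensorial_nabla_q3 nabla_q_P_antiinvariant uX)
  have N2: "(\<Sum>i\<in>UNIV. nabla_q (u k) (u i) (u k) (u i) p) = 0" for k
  proof -
    have "(\<Sum>i\<in>UNIV. nabla_q (u k) (u i) (u i) (u k) p) = 0" by (rule N1)
    moreover have "nabla_q (u k) (u i) (u k) (u i) p = - nabla_q (u k) (u i) (u i) (u k) p" for i
      using nabla_q_skew[OF uX[of k] uX[of i] uX[of k] uX[of i]] by simp
    ultimately show ?thesis by (simp add: sum_negf)
  qed
  have torsion_term: "q (torsion D' (u i) (u k)) (u k) (u i) p = (\<Sum>l\<in>UNIV. ?t i k l * ?q l k i)" for i k
    by (rule tensorial_expand[OF u tensorial_q1[OF uX uX] torsion_X[OF uX uX]])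
  have trace_term: "(\<Sum>k\<in>UNIV. q (u i) (Q (u k) (u k)) (u i) p) = 0" for i
  proof -
    have "(\<Sum>k\<in>UNIV. q (u k) (u k) (Q (u i) (u i)) p) = 0"
      by (rule zero[of "\<lambda>y z. q y z (Q (u i) (u i))"])
        (simp_all add: tensorial_q1 tensorial_q2 q_P_antiinvariant Q_X uX)
    moreover have "q (u i) (Q (u k) (u k)) (u i) p = - q (u k) (u k) (Q (u i) (u i)) p" for k
      using q_skew[OF uX[of i] Q_X[OF uX uX, of k k] uX[of i]] metric(4)[OF Q_X[OF uX uX, of i i] Q_X[OF uX uX, of k k]]
      by simp
    ultimately show ?thesis by (simp add: sum_negf)
  qed
  have square_term: "q (u k) (Q (u i) (u k)) (u i) p = - (\<Sum>l\<in>UNIV. ?q k i l * ?q i k l)" for i k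
  proof -
    have "q (u k) (u i) (Q (u i) (u k)) p = (\<Sum>l\<in>UNIV. ?q i k l * ?q k i l)"
      by (rule tensorial_expand[OF u tensorial_metric_right[OF Q_X[OF uX uX]] Q_X[OF uX uX]])
    then show ?thesis
      using q_skew[OF uX[of k] Q_X[OF uX uX, of i k] uX[of i]] by (simp add: mult.commute)
  qed
  have "g (curvature D' (u i) (u k) (u k)) (u i) p - g (curvature D (u i) (u k) (u k)) (u i) p
      = nabla_q (u i) (u k) (u k) (u i) p - nabla_q (u k) (u i) (u k) (u i) p - q (u i) (Q (u k) (u k)) (u i) p
        + (\<Sum>l\<in>UNIV. ?t i k l * ?q l k i - ?q k i l * ?q i k l)" for i k
    using fun_cong[OF curvature_difference[OF uX[of i] uX[of k] uX[of k] uX[of i]], of p]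
      torsion_term[of i k] square_term[of k i] by (simp add: sum_subtractf)
  then have "scalar_curvature A g D' p - scalar_curvature A g D p
      = (\<Sum>k\<in>UNIV. \<Sum>i\<in>UNIV. nabla_q (u i) (u k) (u k) (u i) p - nabla_q (u k) (u i) (u k) (u i) p
          - q (u i) (Q (u k) (u k)) (u i) p + (\<Sum>l\<in>UNIV. ?t i k l * ?q l k i - ?q k i l * ?q i k l))"
    unfolding scal[OF D] scal[OF D'] by (simp add: sum_subtractf[symmetric])
  also have "\<dots> = (\<Sum>k\<in>UNIV. \<Sum>i\<in>UNIV. nabla_q (u i) (u k) (u k) (u i) p)
      - (\<Sum>k\<in>UNIV. \<Sum>i\<in>UNIV. nabla_q (u k) (u i) (u k) (u i) p)
      - (\<Sum>k\<in>UNIV. \<Sum>i\<in>UNIV. q (u i) (Q (u k) (u k)) (u i) p)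
      + (\<Sum>k\<in>UNIV. \<Sum>i\<in>UNIV. \<Sum>l\<in>UNIV. ?t i k l * ?q l k i - ?q k i l * ?q i k l)"
    by (simp add: sum.distrib sum_subtractf)
  also have "\<dots> = (\<Sum>k\<in>UNIV. \<Sum>i\<in>UNIV. \<Sum>l\<in>UNIV. ?t i k l * ?q l k i - ?q k i l * ?q i k l)"
  proof -
    have "(\<Sum>k\<in>UNIV. \<Sum>i\<in>UNIV. nabla_q (u i) (u k) (u k) (u i) p) = 0"
      by (subst sum.swap) (simp add: N1)
    moreover have "(\<Sum>k\<in>UNIV. \<Sum>i\<in>UNIV. q (u i) (Q (u k) (u k)) (u i) p) = 0"
      by (subst sum.swap) (simp add: trace_term)
    ultimately show ?thesis by (simp add: N2)
  qed
  also have "(\<Sum>k\<in>UNIV. \<Sum>i\<in>UNIV. \<Sum>l\<in>UNIV. ?t i k l * ?q l k i - ?q k i l * ?q i k l)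
      = (\<Sum>i\<in>UNIV. \<Sum>k\<in>UNIV. \<Sum>l\<in>UNIV. ?t i k l * ?q l k i - ?q k i l * ?q i k l)"
    by (rule sum.swap)
  also have "\<dots> = (\<Sum>i\<in>UNIV. \<Sum>k\<in>UNIV. \<Sum>l\<in>UNIV. (?t i k l)\<^sup>2) / 4"
  proof (rule contorsion_quadratic_sum[OF _ _ torsion_cyclic_trace[OF u]])
    show "?t k i l = - ?t i k l" for i k l using T_skew[OF uX uX uX, of i k l] by simp
    show "2 * ?q i k l = ?t i k l - ?t k l i + ?t l i k" for i k l by (rule contorsion[OF uX uX uX])
  qed
  finally show ?thesis using that[OF u] by simp
qed

lemma scalar_curvature_eq_iff_torsion_free:
  "scalar_curvature A g D' = scalar_curvature A g D \<longleftrightarrow> (\<forall>x\<in>X. \<forall>y\<in>X. \<forall>z\<in>X. T x y z = 0)"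
proof
  assume flat: "\<forall>x\<in>X. \<forall>y\<in>X. \<forall>z\<in>X. T x y z = 0"
  show "scalar_curvature A g D' = scalar_curvature A g D"
  proof
    fix p
    show "scalar_curvature A g D' p = scalar_curvature A g D p"
      by (rule scalar_curvature_difference[of p]) (simp add: flat orthonormal_atD(1))
  qed
next
  assume eq: "scalar_curvature A g D' = scalar_curvature A g D"
  have "T x y z p = 0" if v: "x \<in> X" "y \<in> X" "z \<in> X" for x y z p
  proof -
    obtain u where u: "orthonormal_at p u" and diff: "scalar_curvature A g D' p - scalar_curvature A g D p
        = (\<Sum>i\<in>UNIV. \<Sum>k\<in>UNIV. \<Sum>l\<in>UNIV. (T (u i) (u k) (u l) p)\<^sup>2) / 4"
      by (rule scalar_curvature_difference[of p]) blast
    note uX = orthonormal_atD(1)[OF u]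
    have "(\<Sum>i\<in>UNIV. \<Sum>k\<in>UNIV. \<Sum>l\<in>UNIV. (T (u i) (u k) (u l) p)\<^sup>2) = 0" using diff eq by simp
    then have zero: "T (u i) (u k) (u l) p = 0" for i k l
      by (simp add: sum_nonneg_eq_0_iff sum_nonneg)
    have "T (u i) (u k) z p = 0" for i k
      unfolding tensorial_expand[OF u tensorial_T3[OF uX uX] v(3)] by (simp add: zero)
    then have "T (u i) y z p = 0" for i
      unfolding tensorial_expand[OF u tensorial_T2[OF uX v(3)] v(2)] by simp
    then show ?thesis
      unfolding tensorial_expand[OF u tensorial_T1[OF v(2,3)] v(1)] by simp
  qed
  then show "\<forall>x\<in>X. \<forall>y\<in>X. \<forall>z\<in>X. T x y z = 0" by (auto simp: fun_eq_iff)
qed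

text \<open>
  If \<open>\<nabla>P = 0\<close>, then \<open>q x y (P z) = q x (P y) z\<close>. Expressed in \<open>T\<close> by \<open>contorsion\<close> and simplified
  by \<open>torsion_P\<close> this reads \<open>T x y z = T x z y\<close>; a trilinear form that is skew in its first two and
  symmetric in its last two arguments is zero. Conversely \<open>T = 0\<close> gives \<open>q = 0\<close>, that is \<open>D' = D\<close>.
\<close>

lemma P_manifold_iff_torsion_free:
  "P_manifold A P g D \<longleftrightarrow> (\<forall>x\<in>X. \<forall>y\<in>X. \<forall>z\<in>X. T x y z = 0)"
proof
  assume "P_manifold A P g D"
  then have parallel: "deriv_P D P x y = 0" if "x \<in> X" "y \<in> X" for x y
    using that unfolding P_manifold_def by blast
  have F0: "q x y (P z) p = q x (P y) z p" if v: "x \<in> X" "y \<in> X" "z \<in> X" for x y z p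
  proof -
    have "g (0 + 0) z = g 0 z + g 0 z" by (rule metric(2)[OF vf_zero[OF A] vf_zero[OF A] v(3)])
    then have "g (deriv_P D P x y) z = 0" using parallel[OF v(1,2)] by simp
    then show ?thesis using fun_cong[OF F_eq_q[OF v], of p] by simp
  qed
  have last: "T x y z p = T x z y p" if v: "x \<in> X" "y \<in> X" "z \<in> X" for x y z p
  proof -
    \<comment> \<open>With \<open>P y\<close> as second argument, every \<open>P\<close> that \<open>contorsion\<close> and \<open>torsion_P\<close> produce can be moved to
      this argument, where it cancels.\<close>
    note Py = P(1)[OF v(2)]
    show ?thesis
      using F0[OF v(1) Py v(3), of p] P(2)[OF v(2)]
        contorsion[OF v(1) Py P(1)[OF v(3)], of p] contorsion[OF v, of p]
        fun_cong[OF torsion_P(2)[OF v(1) Py v(3)], of p] fun_cong[OF torsion_P(1)[OF v(1) Py v(3)], of p]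
        fun_cong[OF torsion_P(1)[OF Py v(3,1)], of p]
        fun_cong[OF torsion_P(2)[OF v(3,1) Py], of p] fun_cong[OF torsion_P(1)[OF v(3,1) Py], of p]
        fun_cong[OF torsion_P(1)[OF v(3,1,2)], of p] fun_cong[OF torsion_P(2)[OF v(3,1,2)], of p]
        fun_cong[OF T_skew[OF v(3,1,2)], of p]
      by simp
  qed
  have "T x y z p = 0" if v: "x \<in> X" "y \<in> X" "z \<in> X" for x y z p
    using last[OF v, of p] fun_cong[OF T_skew[OF v(1,3,2)], of p] last[OF v(3,1,2), of p]
      fun_cong[OF T_skew[OF v(2,3,1)], of p] last[OF v(2,3,1), of p] fun_cong[OF T_skew[OF v], of p] by simp
  then show "\<forall>x\<in>X. \<forall>y\<in>X. \<forall>z\<in>X. T x y z = 0" by (auto simp: fun_eq_iff)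
next
  assume flat: "\<forall>x\<in>X. \<forall>y\<in>X. \<forall>z\<in>X. T x y z = 0"
  have q0: "q x y z = 0" if v: "x \<in> X" "y \<in> X" "z \<in> X" for x y z
  proof
    fix p show "q x y z p = 0 p" using contorsion[OF v, of p] flat v by simp
  qed
  have "deriv_P D P x y = 0" if v: "x \<in> X" "y \<in> X" for x y
  proof (rule metric_definite)
    show d: "deriv_P D P x y \<in> X" unfolding deriv_P_def by (intro vf_diff[OF A] D_X P v)
    show "g (deriv_P D P x y) (deriv_P D P x y) = 0"
      unfolding F_eq_q[OF v d] by (simp add: q0 P v d)
  qed
  then show "P_manifold A P g D" using W3 unfolding P_manifold_def W3_manifold_def by blast
qed

end

theorem corollary4p4:
  fixes A :: "('a::{t2_space,second_countable_topology}, 'n::finite) atlas"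
    and P :: "'a tensor11" and g :: "'a tensor02"
    and D D' :: "'a connection"
  assumes "W3_manifold A P g D"
    and "levi_civita A g D"
    and "canonical_connection A P g D'"
  shows "P_manifold A P g D \<longleftrightarrow> scalar_curvature A g D' = scalar_curvature A g D"
proof -
  interpret w3_canonical A g P D D'
    using assms by unfold_locales (auto simp: W3_manifold_def riemannian_almost_product_def)
  show ?thesis unfolding P_manifold_iff_torsion_free scalar_curvature_eq_iff_torsion_free ..
qed

end
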